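(* Let $\rho>0$, $\mathbf{u}$, $\theta>0$, $\mathbf{B}$ be sufficiently smooth functions on $\Omega\times(0,T)$ with $\operatorname{div}\mathbf{B}|_{t=0}=0$. Consider the regularized magnetic gas dynamics (MGD) system, i.e. the four equations obtained from the mass, impulse, total energy and Faraday equations of the original system (see the context) by the replacement of terms described in the context: $$\partial_t\rho+\operatorname{div}[\rho\mathbf{u}+\tau\hat{\partial_t}(\rho\mathbf{u})]=0,$$ $$\partial_t(\rho\mathbf{u})+\operatorname{div}[\rho\mathbf{u}\otimes\mathbf{u}-\mathbf{B}\otimes\mathbf{B}+\tau\hat{\partial_t}(\rho\mathbf{u}\otimes\mathbf{u}-\mathbf{B}\otimes\mathbf{B})]+\nabla\left[p+\tfrac12|\mathbf{B}|^2+\tau\hat{\partial_t}\left(p+\tfrac12|\mathbf{B}|^2\right)\right]=\operatorname{div}\Pi_{NS}+(\rho+\tau\hat{\partial_t}\rho)\mathbf{F},$$ $$\partial_t\left(E+\tfrac12|\mathbf{B}|^2\right)+\operatorname{div}\left\{(E+p+|\mathbf{B}|^2)\mathbf{u}-(\mathbf{u}\cdot\mathbf{B})\mathbf{B}+\tau\hat{\partial_t}[(E+p+|\mathbf{B}|^2)\mathbf{u}-(\mathbf{u}\cdot\mathbf{B})\mathbf{B}]\right\}=\operatorname{div}(\varkappa\nabla\theta+\Pi_{NS}\mathbf{u})+[\rho\mathbf{u}+\tau\hat{\partial_t}(\rho\mathbf{u})]\cdot\mathbf{F}+Q,$$ $$\partial_t\mathbf{B}+\operatorname{div}[\mathbf{u}\otimes\mathbf{B}-\mathbf{B}\otimes\mathbf{u}+\tau\hat{\partial_t}(\mathbf{u}\otimes\mathbf{B}-\mathbf{B}\otimes\mathbf{u})]=0.$$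 Then this regularized MGD system has the form (that is, given $\operatorname{div}\mathbf{B}|_{t=0}=0$, it is equivalent to) $$\partial_t\rho+\operatorname{div}[\rho(\mathbf{u}-\mathbf{w})]=0,$$ $$\partial_t(\rho\mathbf{u})+\operatorname{div}[\rho(\mathbf{u}-\mathbf{w})\otimes\mathbf{u}-\mathbf{B}\otimes\mathbf{B}]+\nabla\left(p+\tfrac12|\mathbf{B}|^2\right)=\operatorname{div}\Pi+[\rho-\tau\operatorname{div}(\rho\mathbf{u})]\mathbf{F},$$ $$\partial_t\left(E+\tfrac12|\mathbf{B}|^2\right)+\operatorname{div}\left[(E+p)(\mathbf{u}-\mathbf{w})+|\mathbf{B}|^2(\mathbf{u}-\widehat{\mathbf{w}})-((\mathbf{u}-\widehat{\mathbf{w}})\cdot\mathbf{B})\mathbf{B}\right]=\operatorname{div}\left[-\mathbf{q}+\tau(\boldsymbol\beta\cdot\mathbf{B})\mathbf{u}+\Pi\mathbf{u}\right]+\rho(\mathbf{u}-\mathbf{w})\cdot\mathbf{F}+Q,$$ $$\partial_t\mathbf{B}+\operatorname{div}[(\mathbf{u}-\widehat{\mathbf{w}})\otimes\mathbf{B}-\mathbf{B}\otimes(\mathbf{u}-\widehat{\mathbf{w}})]=\operatorname{div}[\tau(\mathbf{u}\otimes\boldsymbol\beta-\boldsymbol\beta\otimes\mathbf{u})],$$ $$\operatorname{div}\mathbf{B}=0.$$ Here the auxiliary velocities are $$\mathbf{w}=\frac{\tau}{\rho}\left[\operatorname{div}(\rho\mathbf{u}\otimes\mathbf{u}-\mathbf{B}\otimes\mathbf{B})+\nabla\left(p+\tfrac12|\mathbf{B}|^2\right)-\rho\mathbf{F}\right],$$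 $$\widehat{\mathbf{w}}=\frac{\tau}{\rho}\left[\rho(\mathbf{u}\cdot\nabla)\mathbf{u}-\operatorname{div}(\mathbf{B}\otimes\mathbf{B})+\nabla\left(p+\tfrac12|\mathbf{B}|^2\right)-\rho\mathbf{F}\right],$$ the regularized (non-symmetric) viscous stress tensor is $$\Pi=\Pi_{NS}+\rho\mathbf{u}\otimes\widehat{\mathbf{w}}-\tau(\boldsymbol\beta\otimes\mathbf{B}+\mathbf{B}\otimes\boldsymbol\beta)+\tau\left(\mathbf{u}\cdot\nabla p+\rho C_s^2\operatorname{div}\mathbf{u}+\boldsymbol\beta\cdot\mathbf{B}-\frac{p_\theta}{\rho\varepsilon_\theta}Q\right)\mathbb{I},$$ where $C_s\geqslant 0$ is the speed of sound given by $C_s^2=p_\rho+\dfrac{\theta p_\theta^2}{\rho^2\varepsilon_\theta}$, the regularized heat flux $\mathbf{q}$ is given by $$-\mathbf{q}=\varkappa\nabla\theta+\tau\left[\rho\left(\mathbf{u}\cdot\nabla\varepsilon-\frac{p}{\rho^2}\,\mathbf{u}\cdot\nabla\rho\right)-Q\right]\mathbf{u},$$ and $$\boldsymbol\beta=\operatorname{div}(\mathbf{u}\otimes\mathbf{B}-\mathbf{B}\otimes\mathbf{u}).$$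
   Context: **Setting and notation.** $\Omega$ is a domain in $\mathbb{R}^n$, $n\geqslant1$, and $(x,t)\in\Omega\times(0,T)$. The unknowns are the gas density $\rho>0$, velocity $\mathbf{u}=(u_1,\dots,u_n)$, absolute temperature $\theta>0$ and magnetic field $\mathbf{B}=(B_1,\dots,B_n)$. All functions are assumed smooth enough that all derivatives appearing exist and are continuous. $\operatorname{div}$ and $\nabla=(\partial_1,\dots,\partial_n)$ act in $x$; the divergence of a tensor is taken with respect to its first index, $(\operatorname{div}A)_j=\sum_i\partial_iA_{ij}$; $(\mathbf{a}\otimes\mathbf{b})_{ij}=a_ib_j$; $(A\mathbf{u})_i=\sum_jA_{ij}u_j$; $\nabla\mathbf{u}=\{\partial_iu_j\}_{i,j=1}^n$; $\mathbb{I}$ is the identity tensor of order $n$. **State equations.** The pressure $p=p(\rho,\theta)$ and the specific internal energy $\varepsilon=\varepsilon(\rho,\theta)$ are given functions satisfying the Maxwell relation $p=\theta p_\theta+\rho^2\varepsilon_\rho$ and the conditions $p_\rho\geqslant0$, $\varepsilon_\theta>0$ (subscripts $\rho,\theta$ denote partial derivatives of these state functions). The total non-magnetic energy is $E=\frac12\rho|\mathbf{u}|^2+\rho\varepsilon$. **Other data.** $\mathbf{F}=\mathbf{F}(x,t)$ is the given density of body forces, $Q=Q(x,t)\geqslant0$ the given power of heat sources, $\varkappa=\varkappa(\rho,\theta)\geqslant0$ the heat conductivity coefficient, and $\mu=\mu(\rho,\theta)\geqslant0$, $\lambda=\lambda(\rho,\theta)\geqslant0$ the viscosity coefficients. The Navier–Stokes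 viscous stress tensor is $$\Pi_{NS}=\mu\left[2\mathbb{D}(\mathbf{u})-\tfrac23(\operatorname{div}\mathbf{u})\mathbb{I}\right]+\lambda(\operatorname{div}\mathbf{u})\mathbb{I},\qquad \mathbb{D}(\mathbf{u})=\tfrac12(\nabla\mathbf{u}+\nabla\mathbf{u}^T).$$ The relaxation parameter is a given function $\tau=\tau(\rho,\varepsilon,\mathbf{u},\mathbf{B})>0$. **Original system.** $$\partial_t\rho+\operatorname{div}(\rho\mathbf{u})=0,$$ $$\partial_t(\rho\mathbf{u})+\operatorname{div}(\rho\mathbf{u}\otimes\mathbf{u}-\mathbf{B}\otimes\mathbf{B})+\nabla\left(p+\tfrac12|\mathbf{B}|^2\right)=\operatorname{div}\Pi_{NS}+\rho\mathbf{F},$$ $$\partial_t\left(E+\tfrac12|\mathbf{B}|^2\right)+\operatorname{div}[(E+p+|\mathbf{B}|^2)\mathbf{u}-(\mathbf{u}\cdot\mathbf{B})\mathbf{B}]=\operatorname{div}(\varkappa\nabla\theta+\Pi_{NS}\mathbf{u})+\rho\mathbf{u}\cdot\mathbf{F}+Q,$$ $$\partial_t\mathbf{B}+\operatorname{div}(\mathbf{u}\otimes\mathbf{B}-\mathbf{B}\otimes\mathbf{u})=0,\qquad \operatorname{div}\mathbf{B}=0.$$ **The operator $\hat{\partial_t}$.** The hat means that the time derivative is calculated by virtue of the original system with viscosity and heat conductivity neglected ($\Pi_{NS}=0$, $\varkappa=0$). That is, $\hat{\partial_t}$ acts on smooth functions of $(\rho,\mathbf{u},\theta,\mathbf{B})$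 by the chain rule, where $\hat{\partial_t}\rho$, $\hat{\partial_t}\mathbf{u}$, $\hat{\partial_t}\theta$, $\hat{\partial_t}\mathbf{B}$ are the expressions in spatial derivatives determined (using $\rho>0$, $\varepsilon_\theta>0$) by $$\hat{\partial_t}\rho=-\operatorname{div}(\rho\mathbf{u}),\qquad \hat{\partial_t}(\rho\mathbf{u})=-\operatorname{div}(\rho\mathbf{u}\otimes\mathbf{u}-\mathbf{B}\otimes\mathbf{B})-\nabla\left(p+\tfrac12|\mathbf{B}|^2\right)+\rho\mathbf{F},$$ $$\hat{\partial_t}\left(E+\tfrac12|\mathbf{B}|^2\right)=-\operatorname{div}[(E+p+|\mathbf{B}|^2)\mathbf{u}-(\mathbf{u}\cdot\mathbf{B})\mathbf{B}]+\rho\mathbf{u}\cdot\mathbf{F}+Q,\qquad \hat{\partial_t}\mathbf{B}=-\operatorname{div}(\mathbf{u}\otimes\mathbf{B}-\mathbf{B}\otimes\mathbf{u}).$$ **Regularization (replacement of terms).** In the original equations, the terms $\rho\mathbf{u}$ (mass flux); $\rho\mathbf{u}\otimes\mathbf{u}-\mathbf{B}\otimes\mathbf{B}$; $\nabla(p+\frac12|\mathbf{B}|^2)-\rho\mathbf{F}$; $(E+p+|\mathbf{B}|^2)\mathbf{u}-(\mathbf{u}\cdot\mathbf{B})\mathbf{B}$; $\rho\mathbf{u}\cdot\mathbf{F}$; $\mathbf{u}\otimes\mathbf{B}-\mathbf{B}\otimes\mathbf{u}$ are replaced respectively by $\rho\mathbf{u}+\tau\hat{\partial_t}(\rho\mathbf{u})$;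 $\rho\mathbf{u}\otimes\mathbf{u}-\mathbf{B}\otimes\mathbf{B}+\tau\hat{\partial_t}(\rho\mathbf{u}\otimes\mathbf{u}-\mathbf{B}\otimes\mathbf{B})$; $\nabla[p+\frac12|\mathbf{B}|^2+\tau\hat{\partial_t}(p+\frac12|\mathbf{B}|^2)]-(\rho+\tau\hat{\partial_t}\rho)\mathbf{F}$; $(E+p+|\mathbf{B}|^2)\mathbf{u}-(\mathbf{u}\cdot\mathbf{B})\mathbf{B}+\tau\hat{\partial_t}[(E+p+|\mathbf{B}|^2)\mathbf{u}-(\mathbf{u}\cdot\mathbf{B})\mathbf{B}]$; $[\rho\mathbf{u}+\tau\hat{\partial_t}(\rho\mathbf{u})]\cdot\mathbf{F}$; $\mathbf{u}\otimes\mathbf{B}-\mathbf{B}\otimes\mathbf{u}+\tau\hat{\partial_t}(\mathbf{u}\otimes\mathbf{B}-\mathbf{B}\otimes\mathbf{u})$. *)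

theory Defs
  imports "HOL-Analysis.Analysis"
begin

text \<open>
  Class \<open>C\<^sup>k\<close>: all iterated directional derivatives up to order \<open>k\<close> exist and are continuous
  on \<open>S\<close>. Differentiability is taken at the points of \<open>S\<close> (not within \<open>S\<close>); it is only used
  for open \<open>S\<close>.
\<close>
primrec Ck_on :: "nat \<Rightarrow> ('a::euclidean_space \<Rightarrow> 'b::real_normed_vector) \<Rightarrow> 'a set \<Rightarrow> bool" where
  "Ck_on 0 f S \<longleftrightarrow> continuous_on S f"
| "Ck_on (Suc k) f S \<longleftrightarrow>
     (\<forall>x\<in>S. f differentiable (at x)) \<and>
     (\<forall>v. Ck_on k (\<lambda>x. frechet_derivative f (at x) v) S)"

text \<open>
  Differential operators on functions of a space-time point \<open>z = (x, t)\<close>. The divergence of a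
  tensor is taken with respect to its first index.
\<close>
definition dt :: "((real^'n) \<times> real \<Rightarrow> 'b::real_normed_vector) \<Rightarrow> (real^'n) \<times> real \<Rightarrow> 'b" where
  "dt f z = vector_derivative (\<lambda>s. f (fst z, s)) (at (snd z))"

definition dx :: "'n \<Rightarrow> ((real^'n) \<times> real \<Rightarrow> real) \<Rightarrow> (real^'n) \<times> real \<Rightarrow> real" where
  "dx i f z = deriv (\<lambda>s. f (fst z + s *\<^sub>R axis i 1, snd z)) 0"

definition grad :: "((real^'n) \<times> real \<Rightarrow> real) \<Rightarrow> (real^'n) \<times> real \<Rightarrow> real^'n" where
  "grad f z = (\<chi> i. dx i f z)"

definition gradv :: "((real^'n) \<times> real \<Rightarrow> real^'n) \<Rightarrow> (real^'n) \<times> real \<Rightarrow> real^'n^'n" where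
  "gradv f z = (\<chi> i j. dx i (\<lambda>y. f y $ j) z)"

definition divv :: "((real^'n) \<times> real \<Rightarrow> real^'n) \<Rightarrow> (real^'n) \<times> real \<Rightarrow> real" where
  "divv f z = (\<Sum>i\<in>UNIV. dx i (\<lambda>y. f y $ i) z)"

definition divt :: "((real^'n) \<times> real \<Rightarrow> real^'n^'n) \<Rightarrow> (real^'n) \<times> real \<Rightarrow> real^'n" where
  "divt A z = (\<chi> j. \<Sum>i\<in>UNIV. dx i (\<lambda>y. A y $ i $ j) z)"

definition convect :: "((real^'n) \<times> real \<Rightarrow> real^'n) \<Rightarrow> ((real^'n) \<times> real \<Rightarrow> real^'n) \<Rightarrow>
    (real^'n) \<times> real \<Rightarrow> real^'n" where
  "convect a f z = (\<chi> j. \<Sum>i\<in>UNIV. a z $ i * dx i (\<lambda>y. f y $ j) z)"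

definition tensor :: "real^'n \<Rightarrow> real^'n \<Rightarrow> real^'n^'n" (infixl "\<otimes>" 72) where
  "a \<otimes> b = (\<chi> i j. a $ i * b $ j)"

text \<open>Partial derivatives of functions of two real arguments.\<close>
definition D1 :: "(real \<Rightarrow> real \<Rightarrow> real) \<Rightarrow> real \<Rightarrow> real \<Rightarrow> real" where
  "D1 f r h = deriv (\<lambda>s. f s h) r"

definition D2 :: "(real \<Rightarrow> real \<Rightarrow> real) \<Rightarrow> real \<Rightarrow> real \<Rightarrow> real" where
  "D2 f r h = deriv (\<lambda>s. f r s) h"

text \<open>A state is a tuple (density, velocity, temperature, magnetic field).\<close>
type_synonym 'n mgd_state = "real \<times> (real^'n) \<times> real \<times> (real^'n)"

text \<open>
  The locale has no assumptions; it only fixes the state functions, the coefficients, the data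
  and the unknown fields.
\<close>
locale mgd =
  fixes p \<epsilon> \<mu> lam \<kappa> :: "real \<Rightarrow> real \<Rightarrow> real"
    and \<tau> :: "real \<Rightarrow> real \<Rightarrow> real^'n \<Rightarrow> real^'n \<Rightarrow> real"
    and F :: "(real^'n) \<times> real \<Rightarrow> real^'n"
    and Q :: "(real^'n) \<times> real \<Rightarrow> real"
    and \<rho> :: "(real^'n) \<times> real \<Rightarrow> real"
    and u :: "(real^'n) \<times> real \<Rightarrow> real^'n"
    and \<theta> :: "(real^'n) \<times> real \<Rightarrow> real"
    and B :: "(real^'n) \<times> real \<Rightarrow> real^'n"
begin

text \<open>Functions of the state \<open>(r, v, h, b)\<close>.\<close>

definition mass_density :: "'n mgd_state \<Rightarrow> real" where
  "mass_density = (\<lambda>(r, v, h, b). r)"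

definition magnetic_field :: "'n mgd_state \<Rightarrow> real^'n" where
  "magnetic_field = (\<lambda>(r, v, h, b). b)"

definition momentum :: "'n mgd_state \<Rightarrow> real^'n" where
  "momentum = (\<lambda>(r, v, h, b). r *\<^sub>R v)"

definition impulse_flux :: "'n mgd_state \<Rightarrow> real^'n^'n" where
  "impulse_flux = (\<lambda>(r, v, h, b). (r *\<^sub>R v) \<otimes> v - b \<otimes> b)"

definition total_pressure :: "'n mgd_state \<Rightarrow> real" where
  "total_pressure = (\<lambda>(r, v, h, b). p r h + 1/2 * (norm b)\<^sup>2)"

definition energy :: "'n mgd_state \<Rightarrow> real" where
  "energy = (\<lambda>(r, v, h, b). 1/2 * r * (norm v)\<^sup>2 + r * \<epsilon> r h)"

definition total_energy :: "'n mgd_state \<Rightarrow> real" where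
  "total_energy = (\<lambda>(r, v, h, b). energy (r, v, h, b) + 1/2 * (norm b)\<^sup>2)"

definition energy_flux :: "'n mgd_state \<Rightarrow> real^'n" where
  "energy_flux = (\<lambda>(r, v, h, b).
     (energy (r, v, h, b) + p r h + (norm b)\<^sup>2) *\<^sub>R v - (v \<bullet> b) *\<^sub>R b)"

definition faraday_flux :: "'n mgd_state \<Rightarrow> real^'n^'n" where
  "faraday_flux = (\<lambda>(r, v, h, b). v \<otimes> b - b \<otimes> v)"

text \<open>Fields on space-time.\<close>

definition U :: "(real^'n) \<times> real \<Rightarrow> 'n mgd_state" where
  "U z = (\<rho> z, u z, \<theta> z, B z)"

definition prs :: "(real^'n) \<times> real \<Rightarrow> real" where
  "prs z = p (\<rho> z) (\<theta> z)"

definition eint :: "(real^'n) \<times> real \<Rightarrow> real" where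
  "eint z = \<epsilon> (\<rho> z) (\<theta> z)"

definition En :: "(real^'n) \<times> real \<Rightarrow> real" where
  "En z = 1/2 * \<rho> z * (norm (u z))\<^sup>2 + \<rho> z * eint z"

definition tau :: "(real^'n) \<times> real \<Rightarrow> real" where
  "tau z = \<tau> (\<rho> z) (eint z) (u z) (B z)"

definition kap :: "(real^'n) \<times> real \<Rightarrow> real" where
  "kap z = \<kappa> (\<rho> z) (\<theta> z)"

definition DD :: "(real^'n) \<times> real \<Rightarrow> real^'n^'n" where
  "DD z = (1/2) *\<^sub>R (gradv u z + transpose (gradv u z))"

definition Pi_NS :: "(real^'n) \<times> real \<Rightarrow> real^'n^'n" where
  "Pi_NS z = \<mu> (\<rho> z) (\<theta> z) *\<^sub>R (2 *\<^sub>R DD z - (2/3 * divv u z) *\<^sub>R mat 1)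
     + (lam (\<rho> z) (\<theta> z) * divv u z) *\<^sub>R mat 1"

text \<open>
  The time derivative by virtue of the system without viscosity and heat conduction: at each
  point, \<open>V\<close> collects the values of this derivative on density, velocity, temperature and
  magnetic field, determined by the equations after applying the chain rule on the left; on any
  other function of the state it acts by the chain rule as well.
\<close>
definition inviscid_rate :: "(real^'n) \<times> real \<Rightarrow> 'n mgd_state \<Rightarrow> bool" where
  "inviscid_rate z V \<longleftrightarrow>
     frechet_derivative mass_density (at (U z)) V = - divv (\<lambda>y. momentum (U y)) z \<and>
     frechet_derivative momentum (at (U z)) V =
       - divt (\<lambda>y. impulse_flux (U y)) z - grad (\<lambda>y. total_pressure (U y)) z + \<rho> z *\<^sub>R F z \<and>
     frechet_derivative total_energy (at (U z)) V =
       - divv (\<lambda>y. energy_flux (U y)) z + \<rho> z * (u z \<bullet> F z) + Q z \<and>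
     frechet_derivative magnetic_field (at (U z)) V = - divt (\<lambda>y. faraday_flux (U y)) z"

definition hat_dt :: "('n mgd_state \<Rightarrow> 'b::real_normed_vector) \<Rightarrow> (real^'n) \<times> real \<Rightarrow> 'b" where
  "hat_dt \<Phi> z = frechet_derivative \<Phi> (at (U z)) (THE V. inviscid_rate z V)"

definition reg :: "('n mgd_state \<Rightarrow> 'b::real_normed_vector) \<Rightarrow> (real^'n) \<times> real \<Rightarrow> 'b" where
  "reg \<Phi> z = \<Phi> (U z) + tau z *\<^sub>R hat_dt \<Phi> z"

definition regularized_system :: "(real^'n) \<times> real \<Rightarrow> bool" where
  "regularized_system z \<longleftrightarrow>
     dt \<rho> z + divv (reg momentum) z = 0 \<and>
     dt (\<lambda>y. \<rho> y *\<^sub>R u y) z + divt (reg impulse_flux) z + grad (reg total_pressure) z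
       = divt Pi_NS z + reg mass_density z *\<^sub>R F z \<and>
     dt (\<lambda>y. En y + 1/2 * (norm (B y))\<^sup>2) z + divv (reg energy_flux) z
       = divv (\<lambda>y. kap y *\<^sub>R grad \<theta> y + Pi_NS y *v u y) z + reg momentum z \<bullet> F z + Q z \<and>
     dt B z + divt (reg faraday_flux) z = 0"

text \<open>Auxiliary quantities of the transformed system.\<close>

definition w :: "(real^'n) \<times> real \<Rightarrow> real^'n" where
  "w z = (tau z / \<rho> z) *\<^sub>R
     (divt (\<lambda>y. (\<rho> y *\<^sub>R u y) \<otimes> u y - B y \<otimes> B y) z
      + grad (\<lambda>y. prs y + 1/2 * (norm (B y))\<^sup>2) z - \<rho> z *\<^sub>R F z)"

definition w_hat :: "(real^'n) \<times> real \<Rightarrow> real^'n" where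
  "w_hat z = (tau z / \<rho> z) *\<^sub>R
     (\<rho> z *\<^sub>R convect u u z - divt (\<lambda>y. B y \<otimes> B y) z
      + grad (\<lambda>y. prs y + 1/2 * (norm (B y))\<^sup>2) z - \<rho> z *\<^sub>R F z)"

definition \<beta> :: "(real^'n) \<times> real \<Rightarrow> real^'n" where
  "\<beta> z = divt (\<lambda>y. u y \<otimes> B y - B y \<otimes> u y) z"

definition C_s :: "(real^'n) \<times> real \<Rightarrow> real" where
  "C_s z = sqrt (D1 p (\<rho> z) (\<theta> z)
     + \<theta> z * (D2 p (\<rho> z) (\<theta> z))\<^sup>2 / ((\<rho> z)\<^sup>2 * D2 \<epsilon> (\<rho> z) (\<theta> z)))"

definition Pi_reg :: "(real^'n) \<times> real \<Rightarrow> real^'n^'n" where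
  "Pi_reg z = Pi_NS z + (\<rho> z *\<^sub>R u z) \<otimes> w_hat z - tau z *\<^sub>R (\<beta> z \<otimes> B z + B z \<otimes> \<beta> z)
     + (tau z * (u z \<bullet> grad prs z + \<rho> z * (C_s z)\<^sup>2 * divv u z + \<beta> z \<bullet> B z
          - D2 p (\<rho> z) (\<theta> z) / (\<rho> z * D2 \<epsilon> (\<rho> z) (\<theta> z)) * Q z)) *\<^sub>R mat 1"

definition q :: "(real^'n) \<times> real \<Rightarrow> real^'n" where
  "q z = - (kap z *\<^sub>R grad \<theta> z
     + (tau z * (\<rho> z * (u z \<bullet> grad eint z - prs z / (\<rho> z)\<^sup>2 * (u z \<bullet> grad \<rho> z)) - Q z)) *\<^sub>R u z)"

definition transformed_system :: "(real^'n) \<times> real \<Rightarrow> bool" where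
  "transformed_system z \<longleftrightarrow>
     dt \<rho> z + divv (\<lambda>y. \<rho> y *\<^sub>R (u y - w y)) z = 0 \<and>
     dt (\<lambda>y. \<rho> y *\<^sub>R u y) z + divt (\<lambda>y. (\<rho> y *\<^sub>R (u y - w y)) \<otimes> u y - B y \<otimes> B y) z
       + grad (\<lambda>y. prs y + 1/2 * (norm (B y))\<^sup>2) z
       = divt Pi_reg z + (\<rho> z - tau z * divv (\<lambda>y. \<rho> y *\<^sub>R u y) z) *\<^sub>R F z \<and>
     dt (\<lambda>y. En y + 1/2 * (norm (B y))\<^sup>2) z
       + divv (\<lambda>y. (En y + prs y) *\<^sub>R (u y - w y) + (norm (B y))\<^sup>2 *\<^sub>R (u y - w_hat y)
                  - ((u y - w_hat y) \<bullet> B y) *\<^sub>R B y) z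
       = divv (\<lambda>y. - q y + (tau y * (\<beta> y \<bullet> B y)) *\<^sub>R u y + Pi_reg y *v u y) z
         + \<rho> z * ((u z - w z) \<bullet> F z) + Q z \<and>
     dt B z + divt (\<lambda>y. (u y - w_hat y) \<otimes> B y - B y \<otimes> (u y - w_hat y)) z
       = divt (\<lambda>y. tau y *\<^sub>R (u y \<otimes> \<beta> y - \<beta> y \<otimes> u y)) z \<and>
     divv B z = 0"

end

end

theory Submission
  imports Defs
begin

text \<open>
  Write \<open>V = (r, v, h, b)\<close> for the inviscid rates of density, velocity, temperature and magnetic
  field. The mass, impulse and Faraday equations give \<open>r = - div (\<rho> u)\<close>,
  \<open>\<tau> v = - w_hat\<close>, \<open>b = - \<beta>\<close> and \<open>\<tau> (\<rho> v + r u) = - \<rho> w\<close> outright. If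
  \<open>div B = 0\<close>, subtracting the kinetic and magnetic parts from the energy equation leaves
  \<open>\<rho> (\<epsilon>\<^sub>\<rho> r + \<epsilon>\<^sub>\<theta> h) = Q - \<rho> u \<bullet> \<nabla>\<epsilon> - p div u\<close>, and the Maxwell
  relation turns this into the rate of the pressure, in which \<open>C_s\<^sup>2\<close> appears. Substituted into the
  regularized fluxes, these rates give the transformed fluxes pointwise, so the systems agree once
  \<open>div B = 0\<close>. For the regularized system this constraint is recovered from the Faraday equation:
  its flux is antisymmetric and of class \<open>C\<^sup>2\<close>, so \<open>div B\<close> does not depend on time and equals its
  initial value.
\<close>

subsection \<open>Functions of class \<open>C\<^sup>k\<close>\<close>

text \<open>The obstacle is a circularity: \<open>hat_dt\<close> is a definite description that
  involves the energy equation, and the regularized pressure and energy flux take their transformed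
  form only under \<open>div B = 0\<close>, which for the regularized system has yet to be derived.
  It is broken because the rates of \<rho>, u and B are fixed by equations free of the temperature
  rate. Existence and uniqueness of all rates, and the closed form of the Faraday flux, therefore
  hold with no constraint on B; only the value of the temperature rate, which enters the pressure
  and the energy flux, calls for it. The two auxiliary velocities reflect the two ways in which the
  velocity rate occurs: within the momentum rate \<open>\<rho> v + r u\<close> it produces
  \<open>w\<close>, on its own it produces \<open>w_hat\<close>. The gap between them is a multiple
  of u with factor \<open>\<tau> div (\<rho> u) / \<rho>\<close>, and it has to be absorbed by the
  heat flux.\<close>

lemma Ck_on_imp_continuous_on: "Ck_on k f S \<Longrightarrow> continuous_on S f"
  by (cases k) (auto intro!: differentiable_imp_continuous_on differentiable_at_imp_differentiable_on)

lemma Ck_on_SucD: "Ck_on (Suc k) f S \<Longrightarrow> Ck_on k f S"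
proof (induction k arbitrary: f)
  case 0
  then show ?case
    using Ck_on_imp_continuous_on[of "Suc 0" f S] by simp
next
  case (Suc k)
  then show ?case by (metis Ck_on.simps(2))
qed

lemma Ck_on_antimono: "Ck_on k f S \<Longrightarrow> j \<le> k \<Longrightarrow> Ck_on j f S"
proof (induction k)
  case (Suc k)
  then show ?case using Ck_on_SucD[of k f S] by (cases "j = Suc k") auto
qed simp

lemma Ck_on_differentiable: "Ck_on k f S \<Longrightarrow> 0 < k \<Longrightarrow> x \<in> S \<Longrightarrow> f differentiable (at x)"
  by (cases k) auto

text \<open>Differentiability at a point sees a neighbourhood, so agreement on an open set carries
  over to the derivatives, and the induction continues with these. The inner claim is one
  implication for arbitrary functions; exchanging them gives the other.\<close>

lemma Ck_on_cong:
  assumes "open S" "\<And>x. x \<in> S \<Longrightarrow> f x = g x"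
  shows "Ck_on k f S \<longleftrightarrow> Ck_on k g S"
proof -
  have "Ck_on k g S" if "Ck_on k f S" "\<And>x. x \<in> S \<Longrightarrow> f x = g x" for f g :: "'a \<Rightarrow> 'b"
    using that
  proof (induction k arbitrary: f g)
    case 0
    then show ?case by (simp cong: continuous_on_cong)
  next
    case (Suc k)
    have d: "(g has_derivative frechet_derivative f (at x)) (at x)" if "x \<in> S" for x
      using Suc.prems that \<open>open S\<close>
      by (auto simp: frechet_derivative_works intro: has_derivative_transform_within_open)
    then have "frechet_derivative f (at x) = frechet_derivative g (at x)" if "x \<in> S" for x
      using that frechet_derivative_at by blast
    then show ?case
      using d Suc.prems Suc.IH[of "\<lambda>x. frechet_derivative f (at x) v" "\<lambda>x. frechet_derivative g (at x) v" for v]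
      by (auto simp: differentiable_def)
  qed
  then show ?thesis using assms(2) by (metis (no_types))
qed

text \<open>Allows a derivative to be exhibited by the usual rules; by uniqueness it agrees with
  \<open>frechet_derivative\<close> on the open set. The inductions for linear images, sums,
  products, compositions and inverses pass through this rule.\<close>

lemma Ck_on_SucI:
  assumes "open S" "\<And>x. x \<in> S \<Longrightarrow> (f has_derivative f' x) (at x)" "\<And>v. Ck_on k (\<lambda>x. f' x v) S"
  shows "Ck_on (Suc k) f S"
proof -
  have "f' x = frechet_derivative f (at x)" if "x \<in> S" for x
    using assms(2)[OF that] by (rule frechet_derivative_at)
  then have "Ck_on k (\<lambda>x. frechet_derivative f (at x) v) S" for v
    using assms(3)[of v] Ck_on_cong[OF \<open>open S\<close>, of "\<lambda>x. f' x v"] by simp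
  then show ?thesis
    using assms(2) by (auto simp: differentiable_def)
qed

lemma Ck_on_has_derivative:
  "Ck_on k f S \<Longrightarrow> 0 < k \<Longrightarrow> x \<in> S \<Longrightarrow> (f has_derivative frechet_derivative f (at x)) (at x)"
  using Ck_on_differentiable frechet_derivative_works by blast

lemma Ck_on_frechet_derivative: "Ck_on (Suc k) f S \<Longrightarrow> Ck_on k (\<lambda>x. frechet_derivative f (at x) v) S"
  by simp

lemma Ck_on_const: "Ck_on k (\<lambda>x. c) S"
  by (induction k arbitrary: c) auto

lemma Ck_on_bounded_linear:
  assumes "open S" "bounded_linear L" "Ck_on k f S"
  shows "Ck_on k (\<lambda>x. L (f x)) S"
  using assms(3)
proof (induction k arbitrary: f)
  case 0
  then show ?case
    by (auto intro: bounded_linear.continuous_on[OF assms(2)])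
next
  case (Suc k)
  show ?case
    by (rule Ck_on_SucI[OF \<open>open S\<close>, where f' = "\<lambda>x v. L (frechet_derivative f (at x) v)"])
      (use Suc in \<open>auto intro!: bounded_linear.has_derivative[OF assms(2)] simp: frechet_derivative_works\<close>)
qed

lemma Ck_on_add:
  assumes "open S" "Ck_on k f S" "Ck_on k g S"
  shows "Ck_on k (\<lambda>x. f x + g x) S"
  using assms(2,3)
proof (induction k arbitrary: f g)
  case 0
  then show ?case by (auto intro: continuous_on_add)
next
  case (Suc k)
  show ?case
    by (rule Ck_on_SucI[OF \<open>open S\<close>,
          where f' = "\<lambda>x v. frechet_derivative f (at x) v + frechet_derivative g (at x) v"])
      (use Suc in \<open>auto intro!: has_derivative_add simp: frechet_derivative_works\<close>)
qed

lemma Ck_on_sum: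
  assumes "open S" "\<And>i. i \<in> I \<Longrightarrow> Ck_on k (f i) S"
  shows "Ck_on k (\<lambda>x. \<Sum>i\<in>I. f i x) S"
  using assms(2)
  by (induction I rule: infinite_finite_induct) (auto intro!: Ck_on_const Ck_on_add[OF \<open>open S\<close>])

text \<open>The product rule yields values of the same \<open>h\<close> at functions of lower order,
  so the induction must vary both arguments. One proof serves scalar multiples, inner products,
  tensors and matrix-vector products.\<close>

lemma Ck_on_bounded_bilinear:
  assumes "open S" "bounded_bilinear h" "Ck_on k f S" "Ck_on k g S"
  shows "Ck_on k (\<lambda>x. h (f x) (g x)) S"
  using assms(3,4)
proof (induction k arbitrary: f g)
  case 0
  then show ?case
    by (auto intro: bounded_bilinear.continuous_on[OF assms(2)])
next
  case (Suc k)
  show ?case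
  proof (rule Ck_on_SucI[OF \<open>open S\<close>,
        where f' = "\<lambda>x v. h (f x) (frechet_derivative g (at x) v) + h (frechet_derivative f (at x) v) (g x)"])
    show "Ck_on k (\<lambda>x. h (f x) (frechet_derivative g (at x) v) + h (frechet_derivative f (at x) v) (g x)) S" for v
      by (intro Ck_on_add \<open>open S\<close> Suc.IH Ck_on_frechet_derivative Suc.prems Suc.prems[THEN Ck_on_SucD])
  qed (intro bounded_bilinear.FDERIV[OF assms(2)] Ck_on_has_derivative[OF Suc.prems(1)]
      Ck_on_has_derivative[OF Suc.prems(2)] zero_less_Suc)
qed

text \<open>In the chain rule the direction \<open>g'(x) v\<close> moves with \<open>x\<close>,
  whereas the class controls derivatives in fixed directions only. Expanding this direction in the
  basis leaves fixed directions with smooth coefficients. The set \<open>S'\<close> is arbitrary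
  because \<open>\<tau>\<close> will be composed on the set of states that the state equation
  attains.\<close>

lemma Ck_on_compose:
  fixes f :: "'b::euclidean_space \<Rightarrow> 'c::real_normed_vector"
  assumes "open S" "Ck_on k f S'" "Ck_on k g S" "\<And>x. x \<in> S \<Longrightarrow> g x \<in> S'"
  shows "Ck_on k (\<lambda>x. f (g x)) S"
  using assms(2,3)
proof (induction k arbitrary: f)
  case 0
  then show ?case
    using assms(4) by (auto intro!: continuous_on_compose2[of S' f S g])
next
  case (Suc k)
  let ?D = "\<lambda>x v. \<Sum>b\<in>Basis. (frechet_derivative g (at x) v \<bullet> b) *\<^sub>R frechet_derivative f (at (g x)) b"
  show ?case
  proof (rule Ck_on_SucI[OF \<open>open S\<close>, where f' = ?D])
    fix x assume "x \<in> S"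
    have f: "(f has_derivative frechet_derivative f (at (g x))) (at (g x))"
      using Suc.prems assms(4) \<open>x \<in> S\<close> by (auto simp: frechet_derivative_works)
    then have lin: "linear (frechet_derivative f (at (g x)))"
      using has_derivative_linear by blast
    have g: "(g has_derivative frechet_derivative g (at x)) (at x)"
      using Suc.prems \<open>x \<in> S\<close> by (auto simp: frechet_derivative_works)
    have "frechet_derivative f (at (g x)) (frechet_derivative g (at x) v) = ?D x v" for v
      by (subst euclidean_representation[of "frechet_derivative g (at x) v", symmetric])
        (simp only: linear_sum[OF lin] linear_cmul[OF lin])
    then show "((\<lambda>x. f (g x)) has_derivative ?D x) (at x)"
      using has_derivative_compose[OF g f] by (simp add: o_def)
  next
    show "Ck_on k (\<lambda>x. ?D x v) S" for v
      by (intro Ck_on_sum \<open>open S\<close> Ck_on_bounded_bilinear[OF _ bounded_bilinear_scaleR]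
          Ck_on_bounded_bilinear[OF _ bounded_bilinear_inner] Suc.IH Ck_on_const Ck_on_frechet_derivative
          Suc.prems Suc.prems[THEN Ck_on_SucD])
  qed
qed

lemma Ck_on_inverse:
  fixes f :: "'a::euclidean_space \<Rightarrow> real"
  assumes "open S" "Ck_on k f S" "\<And>x. x \<in> S \<Longrightarrow> f x \<noteq> 0"
  shows "Ck_on k (\<lambda>x. inverse (f x)) S"
  using assms(2)
proof (induction k)
  case 0
  then show ?case using assms(3) by (auto intro!: continuous_intros)
next
  case (Suc k)
  have i: "Ck_on k (\<lambda>x. inverse (f x)) S"
    by (rule Suc.IH[OF Ck_on_SucD[OF Suc.prems]])
  show ?case
  proof (rule Ck_on_SucI[OF \<open>open S\<close>])
    fix x assume "x \<in> S"
    show "((\<lambda>x. inverse (f x)) has_derivative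
      (\<lambda>v. - (inverse (f x) * frechet_derivative f (at x) v * inverse (f x)))) (at x)"
      using \<open>x \<in> S\<close> assms(3) by (intro Deriv.has_derivative_inverse Ck_on_has_derivative[OF Suc.prems]) auto
  next
    show "Ck_on k (\<lambda>x. - (inverse (f x) * frechet_derivative f (at x) v * inverse (f x))) S" for v
      by (intro Ck_on_bounded_linear[OF _ bounded_linear_minus[OF bounded_linear_ident]] i \<open>open S\<close>
          Ck_on_bounded_bilinear[OF _ bounded_bilinear_mult] Ck_on_frechet_derivative[OF Suc.prems])
  qed
qed

lemmas Ck_on_scaleR = Ck_on_bounded_bilinear[OF _ bounded_bilinear_scaleR]
lemmas Ck_on_mult = Ck_on_bounded_bilinear[OF _ bounded_bilinear_mult]
lemmas Ck_on_inner = Ck_on_bounded_bilinear[OF _ bounded_bilinear_inner]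
lemmas Ck_on_minus = Ck_on_bounded_linear[OF _ bounded_linear_minus[OF bounded_linear_ident]]
lemmas Ck_on_nth = Ck_on_bounded_linear[OF _ bounded_linear_vec_nth]

lemma Ck_on_diff:
  "open S \<Longrightarrow> Ck_on k f S \<Longrightarrow> Ck_on k g S \<Longrightarrow> Ck_on k (\<lambda>x. f x - g x) S"
  using Ck_on_add[of S k f "\<lambda>x. - g x"] Ck_on_minus[of S k g] by simp

lemma Ck_on_divide:
  fixes f g :: "'a::euclidean_space \<Rightarrow> real"
  shows "open S \<Longrightarrow> Ck_on k f S \<Longrightarrow> Ck_on k g S \<Longrightarrow> (\<And>x. x \<in> S \<Longrightarrow> g x \<noteq> 0) \<Longrightarrow> Ck_on k (\<lambda>x. f x / g x) S"
  unfolding divide_inverse by (intro Ck_on_mult Ck_on_inverse)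

lemma Ck_on_Pair:
  fixes f :: "'a::euclidean_space \<Rightarrow> 'b::real_normed_vector" and g :: "'a \<Rightarrow> 'c::real_normed_vector"
  assumes "open S" "Ck_on k f S" "Ck_on k g S"
  shows "Ck_on k (\<lambda>x. (f x, g x)) S"
proof -
  have "Ck_on k (\<lambda>x. (f x, 0) + (0, g x)) S"
    using assms
    by (intro Ck_on_add Ck_on_bounded_linear[of S "\<lambda>x. (x, 0)" k f]
        Ck_on_bounded_linear[of S "\<lambda>x. (0, x)" k g] bounded_linear_Pair
        bounded_linear_ident bounded_linear_zero)
  then show ?thesis by simp
qed

lemma bounded_linear_axis: "bounded_linear (axis i :: 'b::real_normed_vector \<Rightarrow> 'b ^ 'n)"
proof (rule bounded_linear_intro)
  show "norm (axis i x :: 'b ^ 'n) \<le> norm x * 1" for x :: 'b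
    by (simp add: norm_vec_def axis_def L2_set_def if_distrib[of norm] if_distrib[of "\<lambda>x. x\<^sup>2"] cong: if_cong)
qed (simp_all add: vec_eq_iff axis_def)

text \<open>The entries may lie in any normed space, so two applications treat a tensor, whose rows
  are vectors.\<close>

lemma Ck_on_vec:
  fixes f :: "'a::euclidean_space \<Rightarrow> 'b::real_normed_vector ^ 'n"
  assumes "open S" "\<And>i. Ck_on k (\<lambda>x. f x $ i) S"
  shows "Ck_on k f S"
proof -
  have "Ck_on k (\<lambda>x. \<Sum>i\<in>UNIV. axis i (f x $ i)) S"
    by (intro Ck_on_sum Ck_on_bounded_linear[OF _ bounded_linear_axis] assms)
  moreover have "(\<Sum>i\<in>UNIV. axis i (f x $ i)) = f x" for x
    by (simp add: vec_eq_iff axis_def if_distrib cong: if_cong)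
  ultimately show ?thesis by simp
qed

section \<open>Symmetry of second derivatives\<close>

lemma has_real_derivative_along_line:
  fixes f :: "'a::real_normed_vector \<Rightarrow> real"
  assumes "(f has_derivative f') (at (a + s *\<^sub>R v + b))"
  shows "((\<lambda>s. f (a + s *\<^sub>R v + b)) has_real_derivative f' v) (at s)"
proof -
  have "((\<lambda>s. a + s *\<^sub>R v + b) has_derivative (\<lambda>r. r *\<^sub>R v)) (at s)"
    by (auto intro!: derivative_eq_intros)
  from has_derivative_compose[OF this assms]
  have "((\<lambda>s. f (a + s *\<^sub>R v + b)) has_derivative (\<lambda>r. f' (r *\<^sub>R v))) (at s)" .
  moreover have "(\<lambda>r. f' (r *\<^sub>R v)) = (*) (f' v)"
    using linear_cmul[OF has_derivative_linear[OF assms]] by (simp add: fun_eq_iff mult.commute)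
  ultimately show ?thesis
    by (simp add: has_field_derivative_def)
qed

text \<open>Two applications of the mean value theorem to the second difference, whose left-hand side
  is symmetric in \<open>v\<close> and \<open>w\<close>.\<close>
lemma second_difference_mean_value:
  fixes f :: "'a::euclidean_space \<Rightarrow> real"
  assumes C2: "Ck_on 2 f (ball z e)" and h: "0 < h" "h * (norm v + norm w) < e"
  shows "\<exists>y \<in> ball z e. f (z + h *\<^sub>R v + h *\<^sub>R w) - f (z + h *\<^sub>R v) - f (z + h *\<^sub>R w) + f z
    = h\<^sup>2 * frechet_derivative (\<lambda>x. frechet_derivative f (at x) v) (at y) w"
proof -
  have mem: "z + s *\<^sub>R v + t *\<^sub>R w \<in> ball z e" if "0 \<le> s" "s \<le> h" "0 \<le> t" "t \<le> h" for s t
  proof -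
    have "norm (s *\<^sub>R v + t *\<^sub>R w) \<le> norm (s *\<^sub>R v) + norm (t *\<^sub>R w)"
      by (rule norm_triangle_ineq)
    also have "\<dots> \<le> h * norm v + h * norm w"
      using that by (intro add_mono) (auto intro!: mult_right_mono)
    finally have "norm (s *\<^sub>R v + t *\<^sub>R w) < e"
      using h by (simp add: distrib_left)
    moreover have "norm (z - (z + s *\<^sub>R v + t *\<^sub>R w)) = norm (s *\<^sub>R v + t *\<^sub>R w)"
      by (metis add.assoc add_diff_cancel_left' norm_minus_commute)
    ultimately show ?thesis
      by (simp add: dist_norm)
  qed
  have f: "(f has_derivative frechet_derivative f (at x)) (at x)" if "x \<in> ball z e" for x
    using Ck_on_has_derivative[OF C2 _ that] by simp
  have f': "((\<lambda>x. frechet_derivative f (at x) v) has_derivative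
      frechet_derivative (\<lambda>x. frechet_derivative f (at x) v) (at x)) (at x)" if "x \<in> ball z e" for x
    using C2 that by (auto simp: numeral_2_eq_2 frechet_derivative_works)
  \<comment> \<open>The increment of \<open>f\<close> in direction \<open>w\<close>, seen as a
    function of the displacement along \<open>v\<close>. Writing \<open>0 *\<^sub>R w\<close> gives
    both terms the same shape, so one derivative formula with a parameter covers them.\<close>
  define G where "G s = f (z + s *\<^sub>R v + h *\<^sub>R w) - f (z + s *\<^sub>R v + 0 *\<^sub>R w)" for s
  have G: "(G has_real_derivative (frechet_derivative f (at (z + s *\<^sub>R v + h *\<^sub>R w)) v
      - frechet_derivative f (at (z + s *\<^sub>R v + 0 *\<^sub>R w)) v)) (at s)" if "0 \<le> s" "s \<le> h" for s
  proof -
    have "((\<lambda>s. f (z + s *\<^sub>R v + t *\<^sub>R w)) has_real_derivative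
      frechet_derivative f (at (z + s *\<^sub>R v + t *\<^sub>R w)) v) (at s)" if "0 \<le> t" "t \<le> h" for t
      by (rule has_real_derivative_along_line[OF f[OF mem]]) (use that \<open>0 \<le> s\<close> \<open>s \<le> h\<close> in auto)
    from this[of h] this[of 0] show ?thesis
      unfolding G_def using h by (intro DERIV_diff) auto
  qed
  obtain s where s: "0 < s" "s < h" and Gs: "G h - G 0 = (h - 0) * (frechet_derivative f (at (z + s *\<^sub>R v + h *\<^sub>R w)) v
      - frechet_derivative f (at (z + s *\<^sub>R v + 0 *\<^sub>R w)) v)"
    using MVT2[OF \<open>0 < h\<close> G] by blast
  have H: "((\<lambda>t. frechet_derivative f (at (z + s *\<^sub>R v + t *\<^sub>R w)) v) has_real_derivative
      frechet_derivative (\<lambda>x. frechet_derivative f (at x) v) (at (z + s *\<^sub>R v + t *\<^sub>R w)) w) (at t)"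
    if "0 \<le> t" "t \<le> h" for t
  proof -
    have "z + s *\<^sub>R v + t *\<^sub>R w \<in> ball z e"
      using mem that s by simp
    from f'[OF this] show ?thesis
      using has_real_derivative_along_line[of "\<lambda>x. frechet_derivative f (at x) v" _ "z + s *\<^sub>R v" t w 0]
      by simp
  qed
  obtain t where t: "0 < t" "t < h" and "frechet_derivative f (at (z + s *\<^sub>R v + h *\<^sub>R w)) v
      - frechet_derivative f (at (z + s *\<^sub>R v + 0 *\<^sub>R w)) v
      = (h - 0) * frechet_derivative (\<lambda>x. frechet_derivative f (at x) v) (at (z + s *\<^sub>R v + t *\<^sub>R w)) w"
    using MVT2[OF \<open>0 < h\<close> H] by blast
  with Gs have "G h - G 0 = h\<^sup>2 * frechet_derivative (\<lambda>x. frechet_derivative f (at x) v) (at (z + s *\<^sub>R v + t *\<^sub>R w)) w"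
    by (simp add: power2_eq_square)
  moreover have "z + s *\<^sub>R v + t *\<^sub>R w \<in> ball z e"
    using mem s t by simp
  ultimately show ?thesis
    unfolding G_def by (intro bexI[of _ "z + s *\<^sub>R v + t *\<^sub>R w"]) (auto simp: algebra_simps)
qed

lemma Ck_on_subset: "Ck_on k f S \<Longrightarrow> S' \<subseteq> S \<Longrightarrow> Ck_on k f S'"
proof (induction k arbitrary: f)
  case 0
  then show ?case using continuous_on_subset[of S f S'] by simp
next
  case (Suc k)
  then show ?case by (simp add: subset_iff)
qed

text \<open>Schwarz's theorem. The second difference, divided by \<open>h\<^sup>2\<close>, is a
  value of each mixed derivative at some point near \<open>z\<close>; by continuity the two values
  at \<open>z\<close> cannot differ.\<close>

lemma frechet_derivative_commute:
  fixes f :: "'a::euclidean_space \<Rightarrow> real"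
  assumes "open S" "Ck_on 2 f S" "z \<in> S"
  shows "frechet_derivative (\<lambda>x. frechet_derivative f (at x) v) (at z) w
    = frechet_derivative (\<lambda>x. frechet_derivative f (at x) w) (at z) v"
    (is "?a z = ?b z")
proof (rule ccontr)
  assume ne: "?a z \<noteq> ?b z"
  \<comment> \<open>Half of the supposed gap: two deviations smaller than \<open>r\<close> cannot
    bridge it.\<close>
  define r where "r = \<bar>?a z - ?b z\<bar> / 2"
  have r: "0 < r" using ne by (simp add: r_def)
  have "continuous_on S ?a" "continuous_on S ?b"
    using assms(2) by (simp_all add: numeral_2_eq_2)
  then have "continuous (at z) ?a" "continuous (at z) ?b"
    using assms(1,3) by (simp_all add: continuous_on_eq_continuous_at)
  then obtain d1 d2 where d: "0 < d1" "0 < d2"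
    "\<And>x. dist x z < d1 \<Longrightarrow> dist (?a x) (?a z) < r" "\<And>x. dist x z < d2 \<Longrightarrow> dist (?b x) (?b z) < r"
    using r unfolding continuous_at_eps_delta by (metis (no_types, lifting))
  obtain d3 where d3: "0 < d3" "ball z d3 \<subseteq> S"
    using assms openE by blast
  define e where "e = min d3 (min d1 d2)"
  \<comment> \<open>The summand 1 keeps the denominator positive even if \<open>v\<close> and
    \<open>w\<close> both vanish.\<close>
  define h where "h = e / (norm v + norm w + 1) / 2"
  have e: "0 < e" using d d3 by (simp add: e_def)
  have pos: "0 < norm v + norm w + 1"
    by (simp add: add_nonneg_pos)
  have h: "0 < h" unfolding h_def using e pos by simp
  have "h * (norm v + norm w) < h * (2 * (norm v + norm w + 1))"
    using h pos by (intro mult_strict_left_mono) (auto intro: add_nonneg_pos)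
  also have "\<dots> = e" unfolding h_def using pos by (simp add: field_simps)
  finally have he: "h * (norm v + norm w) < e" .
  have C2: "Ck_on 2 f (ball z e)"
    by (rule Ck_on_subset[OF assms(2)]) (use d3 in \<open>auto simp: e_def\<close>)
  obtain y1 where y1: "y1 \<in> ball z e" and a:
    "f (z + h *\<^sub>R v + h *\<^sub>R w) - f (z + h *\<^sub>R v) - f (z + h *\<^sub>R w) + f z = h\<^sup>2 * ?a y1"
    using second_difference_mean_value[OF C2 h he] by blast
  obtain y2 where y2: "y2 \<in> ball z e" and b:
    "f (z + h *\<^sub>R w + h *\<^sub>R v) - f (z + h *\<^sub>R w) - f (z + h *\<^sub>R v) + f z = h\<^sup>2 * ?b y2"
    using second_difference_mean_value[OF C2 h, of w v] he unfolding add.commute[of "norm w"] by blast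
  have swap: "z + h *\<^sub>R w + h *\<^sub>R v = z + h *\<^sub>R v + h *\<^sub>R w"
    by simp
  have "h\<^sup>2 * ?a y1 = h\<^sup>2 * ?b y2"
    using a b unfolding swap by linarith
  then have "?a y1 = ?b y2" using h by simp
  moreover have "dist (?a y1) (?a z) < r" "dist (?b y2) (?b z) < r"
    using y1 y2 unfolding e_def mem_ball by (intro d; simp add: dist_commute)+
  ultimately show False
    unfolding r_def dist_real_def by argo
qed

subsection \<open>Differential operators in space-time\<close>

text \<open>Links the derivative along a coordinate line, in terms of which \<open>dx\<close> is
  defined, to the total derivative; the sum and product rules for the spatial operators come from
  here.\<close>

lemma dx_has_derivative:
  assumes "(f has_derivative f') (at z)"
  shows "dx i f z = f' (axis i 1, 0)"
proof -
  have *: "(fst z + s *\<^sub>R axis i 1, snd z) = z + s *\<^sub>R (axis i 1, 0) + 0" for s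
    by (simp add: prod_eq_iff)
  have "((\<lambda>s. f (z + s *\<^sub>R (axis i 1, 0) + 0)) has_real_derivative f' (axis i 1, 0)) (at 0)"
    by (rule has_real_derivative_along_line) (use assms in \<open>simp add: zero_prod_def[symmetric]\<close>)
  then show ?thesis
    unfolding dx_def * by (rule DERIV_imp_deriv)
qed

lemma dx_eq_frechet_derivative:
  "f differentiable (at z) \<Longrightarrow> dx i f z = frechet_derivative f (at z) (axis i 1, 0)"
  by (simp add: dx_has_derivative frechet_derivative_works)

lemma dt_has_vector_derivative:
  assumes "(f has_derivative f') (at (x, t))"
  shows "((\<lambda>s. f (x, s)) has_vector_derivative f' (0, 1)) (at t)"
proof -
  have "((\<lambda>s. (x, s)) has_derivative (\<lambda>s. (0, s))) (at t)"
    by (auto intro!: derivative_eq_intros)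
  from has_derivative_compose[OF this assms]
  have "((\<lambda>s. f (x, s)) has_derivative (\<lambda>s. f' (0, s))) (at t)" .
  moreover have "f' (0, s) = s *\<^sub>R f' (0, 1)" for s
    using linear_cmul[OF has_derivative_linear[OF assms], of s "(0, 1)"] by simp
  then have "(\<lambda>s. f' (0, s)) = (\<lambda>s. s *\<^sub>R f' (0, 1))"
    by (rule ext)
  ultimately show ?thesis
    by (simp only: has_vector_derivative_def)
qed

lemma dt_has_derivative: "(f has_derivative f') (at z) \<Longrightarrow> dt f z = f' (0, 1)"
  using dt_has_vector_derivative[of f f' "fst z" "snd z"]
  by (simp add: dt_def vector_derivative_at)

lemma dt_eq_frechet_derivative:
  "f differentiable (at z) \<Longrightarrow> dt f z = frechet_derivative f (at z) (0, 1)"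
  by (simp add: dt_has_derivative frechet_derivative_works)

text \<open>A short piece of the coordinate line through \<open>z\<close> stays in the open set.
  This is what permits differentiating flux identities that are known on that set only.\<close>

lemma dx_cong:
  assumes "open S" "z \<in> S" "\<And>y. y \<in> S \<Longrightarrow> f y = g y"
  shows "dx i f z = dx i g z"
proof -
  define c where "c s = (fst z + s *\<^sub>R axis i 1, snd z)" for s
  have "isCont c 0"
    unfolding c_def by (intro continuous_intros)
  then have "(c \<longlongrightarrow> c 0) (nhds 0)"
    by (simp only: isCont_def tendsto_at_iff_tendsto_nhds)
  then have "eventually (\<lambda>s. c s \<in> S) (nhds 0)"
    by (rule topological_tendstoD) (use assms(1,2) in \<open>simp_all add: c_def\<close>)
  then show ?thesis
    unfolding dx_def by (intro deriv_cong_ev) (auto elim!: eventually_mono simp: assms(3) c_def)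
qed

lemma grad_cong: "open S \<Longrightarrow> z \<in> S \<Longrightarrow> (\<And>y. y \<in> S \<Longrightarrow> f y = g y) \<Longrightarrow> grad f z = grad g z"
  unfolding grad_def by (simp add: vec_eq_iff dx_cong[of S z f g])

lemma divv_cong: "open S \<Longrightarrow> z \<in> S \<Longrightarrow> (\<And>y. y \<in> S \<Longrightarrow> f y = g y) \<Longrightarrow> divv f z = divv g z"
  unfolding divv_def by (intro sum.cong refl dx_cong[of S]) auto

lemma divt_cong: "open S \<Longrightarrow> z \<in> S \<Longrightarrow> (\<And>y. y \<in> S \<Longrightarrow> f y = g y) \<Longrightarrow> divt f z = divt g z"
  unfolding divt_def vec_eq_iff by (auto intro!: sum.cong dx_cong[of S])

lemma differentiable_vec_nth:
  "f differentiable (at z) \<Longrightarrow> (\<lambda>y. f y $ i) differentiable (at z)"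
  unfolding differentiable_def using bounded_linear.has_derivative[OF bounded_linear_vec_nth] by blast

lemma dx_add: "f differentiable (at z) \<Longrightarrow> g differentiable (at z) \<Longrightarrow>
    dx i (\<lambda>y. f y + g y) z = dx i f z + dx i g z"
  using dx_has_derivative[OF has_derivative_add[of f "frechet_derivative f (at z)" "at z" g "frechet_derivative g (at z)"]]
  by (simp add: dx_eq_frechet_derivative frechet_derivative_works[symmetric])

lemma dx_diff: "f differentiable (at z) \<Longrightarrow> g differentiable (at z) \<Longrightarrow>
    dx i (\<lambda>y. f y - g y) z = dx i f z - dx i g z"
  using dx_has_derivative[OF has_derivative_diff[of f "frechet_derivative f (at z)" "at z" g "frechet_derivative g (at z)"]]
  by (simp add: dx_eq_frechet_derivative frechet_derivative_works[symmetric])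

lemma dx_mult: "f differentiable (at z) \<Longrightarrow> g differentiable (at z) \<Longrightarrow>
    dx i (\<lambda>y. f y * g y) z = f z * dx i g z + dx i f z * g z"
  using dx_has_derivative[OF has_derivative_mult[of f "frechet_derivative f (at z)" z UNIV g "frechet_derivative g (at z)"]]
  by (simp add: dx_eq_frechet_derivative frechet_derivative_works[symmetric])

lemma dx_const: "dx i (\<lambda>y. c) z = 0"
  using dx_has_derivative[of "\<lambda>y. c" "\<lambda>v. 0" z i] by simp

lemma dx_sum:
  assumes "\<And>a. a \<in> I \<Longrightarrow> f a differentiable (at z)"
  shows "dx i (\<lambda>y. \<Sum>a\<in>I. f a y) z = (\<Sum>a\<in>I. dx i (f a) z)"
  using assms
proof (induction I rule: infinite_finite_induct)
  case (insert a I)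
  then have "(\<lambda>y. \<Sum>a\<in>I. f a y) differentiable (at z)"
    by (intro differentiable_sum) auto
  with insert show ?case by (simp add: dx_add)
qed (simp_all add: dx_const)

lemma grad_add: "f differentiable (at z) \<Longrightarrow> g differentiable (at z) \<Longrightarrow>
    grad (\<lambda>y. f y + g y) z = grad f z + grad g z"
  by (simp add: grad_def vec_eq_iff dx_add)

lemma grad_mult: "f differentiable (at z) \<Longrightarrow> g differentiable (at z) \<Longrightarrow>
    grad (\<lambda>y. f y * g y) z = f z *\<^sub>R grad g z + g z *\<^sub>R grad f z"
  by (simp add: grad_def vec_eq_iff dx_mult mult.commute)

text \<open>The product rule for the directional derivative along \<open>c\<close>. It turns the
  gradients of \<open>|u|\<^sup>2\<close>, \<open>|B|\<^sup>2\<close> and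
  \<open>u \<bullet> B\<close> in the energy equation into convective terms that can cancel against
  the other equations.\<close>

lemma inner_grad_inner:
  assumes "a differentiable (at z)" "b differentiable (at z)"
  shows "c z \<bullet> grad (\<lambda>y. a y \<bullet> b y) z = convect c a z \<bullet> b z + convect c b z \<bullet> a z"
proof -
  have "dx i (\<lambda>y. a y \<bullet> b y) z
      = (\<Sum>j\<in>UNIV. dx i (\<lambda>y. a y $ j) z * b z $ j) + (\<Sum>j\<in>UNIV. dx i (\<lambda>y. b y $ j) z * a z $ j)" for i
    unfolding inner_vec_def inner_real_def
    by (subst dx_sum)
      (simp_all add: dx_mult assms differentiable_vec_nth sum.distrib mult.commute add.commute)
  then have "c z \<bullet> grad (\<lambda>y. a y \<bullet> b y) z
      = (\<Sum>i\<in>UNIV. \<Sum>j\<in>UNIV. c z $ i * dx i (\<lambda>y. a y $ j) z * b z $ j)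
        + (\<Sum>i\<in>UNIV. \<Sum>j\<in>UNIV. c z $ i * dx i (\<lambda>y. b y $ j) z * a z $ j)"
    by (simp add: inner_vec_def grad_def distrib_left sum.distrib sum_distrib_left mult.assoc)
  also have "\<dots> = convect c a z \<bullet> b z + convect c b z \<bullet> a z"
    unfolding convect_def inner_vec_def
    by (subst (1 2) sum.swap) (simp add: sum_distrib_right)
  finally show ?thesis .
qed

lemma grad_diff: "f differentiable (at z) \<Longrightarrow> g differentiable (at z) \<Longrightarrow>
    grad (\<lambda>y. f y - g y) z = grad f z - grad g z"
  by (simp add: grad_def vec_eq_iff dx_diff)

lemma grad_cmult: "f differentiable (at z) \<Longrightarrow> grad (\<lambda>y. c * f y) z = c *\<^sub>R grad f z"
  by (simp add: grad_def vec_eq_iff dx_mult dx_const)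

lemma divv_add: "f differentiable (at z) \<Longrightarrow> g differentiable (at z) \<Longrightarrow>
    divv (\<lambda>y. f y + g y) z = divv f z + divv g z"
  by (simp add: divv_def dx_add differentiable_vec_nth sum.distrib)

lemma divv_diff: "f differentiable (at z) \<Longrightarrow> g differentiable (at z) \<Longrightarrow>
    divv (\<lambda>y. f y - g y) z = divv f z - divv g z"
  by (simp add: divv_def dx_diff differentiable_vec_nth sum_subtractf)

lemma divv_scaleR: "f differentiable (at z) \<Longrightarrow> v differentiable (at z) \<Longrightarrow>
    divv (\<lambda>y. f y *\<^sub>R v y) z = f z * divv v z + grad f z \<bullet> v z"
  by (simp add: divv_def grad_def inner_vec_def dx_mult differentiable_vec_nth sum.distrib sum_distrib_left)

lemma divt_add: "f differentiable (at z) \<Longrightarrow> g differentiable (at z) \<Longrightarrow>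
    divt (\<lambda>y. f y + g y) z = divt f z + divt g z"
  by (simp add: divt_def vec_eq_iff dx_add differentiable_vec_nth sum.distrib)

lemma divt_diff: "f differentiable (at z) \<Longrightarrow> g differentiable (at z) \<Longrightarrow>
    divt (\<lambda>y. f y - g y) z = divt f z - divt g z"
  by (simp add: divt_def vec_eq_iff dx_diff differentiable_vec_nth sum_subtractf)

text \<open>Off-diagonal entries are constantly 0 and the diagonal ones are \<open>f\<close>. This
  is how a correction of the pressure becomes an isotropic part of the stress tensor.\<close>

lemma divt_scaleR_mat_1:
  "divt (\<lambda>y. f y *\<^sub>R mat 1) z = grad f z"
proof -
  have "dx i (\<lambda>y. (f y *\<^sub>R mat 1) $ i $ j) z = (if i = j then dx i f z else 0)" for i j
    by (auto simp: mat_def dx_const)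
  then show ?thesis
    by (simp add: divt_def grad_def vec_eq_iff)
qed

section \<open>State functions of two real arguments and their partial derivatives\<close>

lemma has_derivative_partials:
  assumes "(\<lambda>(r, h). f r h) differentiable (at (r, h))"
  shows "((\<lambda>(r, h). f r h) has_derivative (\<lambda>d. D1 f r h * fst d + D2 f r h * snd d)) (at (r, h))"
proof -
  obtain f' where f': "((\<lambda>(r, h). f r h) has_derivative f') (at (r, h))"
    using assms by (auto simp: differentiable_def)
  \<comment> \<open>The line starts at \<open>(0, h)\<close>, so its parameter is the first argument
    itself, as in \<open>D1\<close>.\<close>
  have "((\<lambda>s. (\<lambda>(r, h). f r h) ((0, h) + s *\<^sub>R (1, 0) + 0)) has_real_derivative f' (1, 0)) (at r)"
    by (rule has_real_derivative_along_line) (use f' in simp)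
  then have 1: "D1 f r h = f' (1, 0)"
    unfolding D1_def by (simp add: DERIV_imp_deriv)
  have "((\<lambda>s. (\<lambda>(r, h). f r h) ((r, 0) + s *\<^sub>R (0, 1) + 0)) has_real_derivative f' (0, 1)) (at h)"
    by (rule has_real_derivative_along_line) (use f' in simp)
  then have 2: "D2 f r h = f' (0, 1)"
    unfolding D2_def by (simp add: DERIV_imp_deriv)
  have "f' d = D1 f r h * fst d + D2 f r h * snd d" for d
  proof -
    have "f' (fst d *\<^sub>R (1, 0) + snd d *\<^sub>R (0, 1)) = fst d *\<^sub>R f' (1, 0) + snd d *\<^sub>R f' (0, 1)"
      by (simp only: linear_add[OF has_derivative_linear[OF f']] linear_cmul[OF has_derivative_linear[OF f']])
    moreover have "fst d *\<^sub>R (1, 0) + snd d *\<^sub>R (0, 1) = d"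
      by (simp add: prod_eq_iff)
    ultimately show ?thesis
      by (simp only: 1 2 real_scaleR_def mult.commute)
  qed
  then have "f' = (\<lambda>d. D1 f r h * fst d + D2 f r h * snd d)"
    by (rule ext)
  with f' show ?thesis by simp
qed

lemma Ck_on_D1:
  assumes "open S" "Ck_on (Suc k) (\<lambda>(r, h). f r h) S"
  shows "Ck_on k (\<lambda>(r, h). D1 f r h) S"
proof -
  have "frechet_derivative (\<lambda>(r, h). f r h) (at x) (1, 0) = (\<lambda>(r, h). D1 f r h) x" if "x \<in> S" for x
    using Ck_on_differentiable[OF assms(2) _ that]
    by (cases x) (simp add: frechet_derivative_at[OF has_derivative_partials, symmetric])
  then show ?thesis
    using Ck_on_cong[OF \<open>open S\<close>, of "\<lambda>x. frechet_derivative (\<lambda>(r, h). f r h) (at x) (1, 0)" _ k]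
      Ck_on_frechet_derivative[OF assms(2)] by blast
qed

lemma Ck_on_D2:
  assumes "open S" "Ck_on (Suc k) (\<lambda>(r, h). f r h) S"
  shows "Ck_on k (\<lambda>(r, h). D2 f r h) S"
proof -
  have "frechet_derivative (\<lambda>(r, h). f r h) (at x) (0, 1) = (\<lambda>(r, h). D2 f r h) x" if "x \<in> S" for x
    using Ck_on_differentiable[OF assms(2) _ that]
    by (cases x) (simp add: frechet_derivative_at[OF has_derivative_partials, symmetric])
  then show ?thesis
    using Ck_on_cong[OF \<open>open S\<close>, of "\<lambda>x. frechet_derivative (\<lambda>(r, h). f r h) (at x) (0, 1)" _ k]
      Ck_on_frechet_derivative[OF assms(2)] by blast
qed

lemma Ck_on_compose2:
  fixes f :: "real \<Rightarrow> real \<Rightarrow> real"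
  assumes "open S" "Ck_on k (\<lambda>(r, h). f r h) S'" "Ck_on k a S" "Ck_on k b S" "\<And>x. x \<in> S \<Longrightarrow> (a x, b x) \<in> S'"
  shows "Ck_on k (\<lambda>x. f (a x) (b x)) S"
  using Ck_on_compose[OF assms(1,2) Ck_on_Pair[OF assms(1,3,4)] assms(5)] by simp

lemma has_derivative_compose_partials:
  assumes "(\<lambda>(r, h). f r h) differentiable (at (a z, b z))"
    and "(a has_derivative a') (at z)" "(b has_derivative b') (at z)"
  shows "((\<lambda>y. f (a y) (b y)) has_derivative
    (\<lambda>d. D1 f (a z) (b z) * a' d + D2 f (a z) (b z) * b' d)) (at z)"
  using has_derivative_compose[OF has_derivative_Pair[OF assms(2,3)] has_derivative_partials[OF assms(1)]]
  by simp

lemma grad_compose_partials: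
  assumes "(\<lambda>(r, h). f r h) differentiable (at (a z, b z))"
    and "a differentiable (at z)" "b differentiable (at z)"
  shows "grad (\<lambda>y. f (a y) (b y)) z = D1 f (a z) (b z) *\<^sub>R grad a z + D2 f (a z) (b z) *\<^sub>R grad b z"
  using dx_has_derivative[OF has_derivative_compose_partials[OF assms(1)
        assms(2)[THEN frechet_derivative_works[THEN iffD1]] assms(3)[THEN frechet_derivative_works[THEN iffD1]]]]
  by (simp add: grad_def vec_eq_iff dx_eq_frechet_derivative assms)

section \<open>Tensor products and the regularity of the differential operators\<close>

lemma tensor_nth: "(a \<otimes> b) $ i $ j = a $ i * b $ j"
  by (simp add: tensor_def)

lemma bounded_bilinear_tensor: "bounded_bilinear ((\<otimes>) :: real^'n \<Rightarrow> real^'n \<Rightarrow> real^'n^'n)"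
  unfolding bilinear_conv_bounded_bilinear[symmetric] bilinear_def
  by (auto intro!: linearI simp: vec_eq_iff tensor_nth algebra_simps)

lemma bounded_bilinear_matrix_vector_mult: "bounded_bilinear ((*v) :: real^'n^'m \<Rightarrow> real^'n \<Rightarrow> real^'m)"
  unfolding bilinear_conv_bounded_bilinear[symmetric] bilinear_def
  by (auto intro!: linearI simp: vec_eq_iff matrix_vector_mult_def sum.distrib sum_distrib_left algebra_simps)

lemma tensor_mult_vec: "(a \<otimes> b) *v c = (b \<bullet> c) *\<^sub>R a"
  by (simp add: vec_eq_iff matrix_vector_mult_def tensor_nth inner_vec_def sum_distrib_left sum_distrib_right mult_ac)

text \<open>Since the divergence acts on the first index, the first factor supplies both the
  divergence and the direction of transport. For B with vanishing divergence,
  \<open>div (B \<otimes> B)\<close> is thus purely convective.\<close>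

lemma divt_tensor:
  assumes "a differentiable (at z)" "b differentiable (at z)"
  shows "divt (\<lambda>y. a y \<otimes> b y) z = divv a z *\<^sub>R b z + convect a b z"
  by (simp add: divt_def divv_def convect_def vec_eq_iff tensor_nth dx_mult differentiable_vec_nth assms
      sum.distrib sum_distrib_right add.commute)

lemma Ck_on_tensor: "open S \<Longrightarrow> Ck_on k a S \<Longrightarrow> Ck_on k b S \<Longrightarrow> Ck_on k (\<lambda>z. a z \<otimes> b z) S"
  by (rule Ck_on_bounded_bilinear[OF _ bounded_bilinear_tensor])

lemma Ck_on_matrix_vector_mult:
  fixes A :: "'a::euclidean_space \<Rightarrow> real^'n^'m"
  shows "open S \<Longrightarrow> Ck_on k A S \<Longrightarrow> Ck_on k b S \<Longrightarrow> Ck_on k (\<lambda>z. A z *v b z) S"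
  by (rule Ck_on_bounded_bilinear[OF _ bounded_bilinear_matrix_vector_mult])

lemma Ck_on_dx:
  assumes "open S" "Ck_on (Suc k) f S"
  shows "Ck_on k (dx i f) S"
proof -
  have "dx i f x = frechet_derivative f (at x) (axis i 1, 0)" if "x \<in> S" for x
    using Ck_on_differentiable[OF assms(2) _ that] by (simp add: dx_eq_frechet_derivative)
  then show ?thesis
    using Ck_on_cong[OF \<open>open S\<close>, of "dx i f" "\<lambda>x. frechet_derivative f (at x) (axis i 1, 0)" k]
      Ck_on_frechet_derivative[OF assms(2)] by simp
qed

lemma Ck_on_grad: "open S \<Longrightarrow> Ck_on (Suc k) f S \<Longrightarrow> Ck_on k (grad f) S"
  unfolding grad_def by (rule Ck_on_vec) (simp_all add: Ck_on_dx del: Ck_on.simps)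

lemma Ck_on_gradv: "open S \<Longrightarrow> Ck_on (Suc k) f S \<Longrightarrow> Ck_on k (gradv f) S"
  unfolding gradv_def by (intro Ck_on_vec) (simp_all add: Ck_on_dx Ck_on_nth del: Ck_on.simps)

lemma Ck_on_divv: "open S \<Longrightarrow> Ck_on (Suc k) f S \<Longrightarrow> Ck_on k (divv f) S"
  unfolding divv_def by (intro Ck_on_sum) (simp_all add: Ck_on_dx Ck_on_nth del: Ck_on.simps)

lemma Ck_on_divt: "open S \<Longrightarrow> Ck_on (Suc k) f S \<Longrightarrow> Ck_on k (divt f) S"
  unfolding divt_def by (intro Ck_on_vec) (simp_all add: Ck_on_sum Ck_on_dx Ck_on_nth del: Ck_on.simps)

lemma Ck_on_convect: "open S \<Longrightarrow> Ck_on k a S \<Longrightarrow> Ck_on (Suc k) f S \<Longrightarrow> Ck_on k (convect a f) S"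
  unfolding convect_def
  by (intro Ck_on_vec) (simp_all add: Ck_on_sum Ck_on_mult Ck_on_dx Ck_on_nth del: Ck_on.simps)

section \<open>Exchange of derivatives and the double divergence of an antisymmetric tensor\<close>

lemma dx_commute:
  assumes "open S" "Ck_on 2 f S" "z \<in> S"
  shows "dx i (dx j f) z = dx j (dx i f) z"
proof -
  have C: "Ck_on (Suc 1) f S" using assms(2) by (simp add: numeral_2_eq_2)
  have "dx i (dx j f) z = frechet_derivative (\<lambda>x. frechet_derivative f (at x) (axis j 1, 0)) (at z) (axis i 1, 0)" for i j
  proof -
    have "dx i (dx j f) z = dx i (\<lambda>x. frechet_derivative f (at x) (axis j 1, 0)) z"
      by (rule dx_cong[OF assms(1,3)]) (simp add: dx_eq_frechet_derivative Ck_on_differentiable[OF C])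
    also have "\<dots> = frechet_derivative (\<lambda>x. frechet_derivative f (at x) (axis j 1, 0)) (at z) (axis i 1, 0)"
      by (rule dx_eq_frechet_derivative)
        (rule Ck_on_differentiable[OF Ck_on_frechet_derivative[OF C] _ \<open>z \<in> S\<close>], simp)
    finally show ?thesis .
  qed
  then show ?thesis
    using frechet_derivative_commute[OF assms] by simp
qed

lemma dt_dx_commute:
  assumes "open S" "Ck_on 2 f S" "z \<in> S"
  shows "dx i (dt f) z = frechet_derivative (dx i f) (at z) (0, 1)"
proof -
  have C: "Ck_on (Suc 1) f S" using assms(2) by (simp add: numeral_2_eq_2)
  have d: "f differentiable (at x)" if "x \<in> S" for x
    using Ck_on_differentiable[OF C _ that] by simp
  have d2: "(\<lambda>x. frechet_derivative f (at x) v) differentiable (at z)" for v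
    using Ck_on_differentiable[OF Ck_on_frechet_derivative[OF C] _ \<open>z \<in> S\<close>] by simp
  have "dx i (dt f) z = dx i (\<lambda>x. frechet_derivative f (at x) (0, 1)) z"
    by (rule dx_cong[OF assms(1,3)]) (simp add: dt_eq_frechet_derivative d)
  also have "\<dots> = frechet_derivative (\<lambda>x. frechet_derivative f (at x) (0, 1)) (at z) (axis i 1, 0)"
    by (rule dx_eq_frechet_derivative[OF d2])
  also have "\<dots> = frechet_derivative (\<lambda>x. frechet_derivative f (at x) (axis i 1, 0)) (at z) (0, 1)"
    by (rule frechet_derivative_commute[OF assms])
  also have "\<dots> = frechet_derivative (dx i f) (at z) (0, 1)"
    by (subst frechet_derivative_transform_within_open[OF d2 assms(1,3)])
      (simp_all add: dx_eq_frechet_derivative d)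
  finally show ?thesis .
qed

lemma dt_vec_nth:
  assumes "f differentiable (at z)"
  shows "dt f z $ i = dt (\<lambda>y. f y $ i) z"
proof -
  obtain f' where f': "(f has_derivative f') (at z)"
    using assms by (auto simp: differentiable_def)
  show ?thesis
    using dt_has_derivative[OF f'] dt_has_derivative[OF bounded_linear.has_derivative[OF bounded_linear_vec_nth f']]
    by simp
qed

lemma divv_dt_commute:
  assumes "open S" "Ck_on 2 f S" "z \<in> S"
  shows "divv (dt f) z = frechet_derivative (divv f) (at z) (0, 1)"
proof -
  have C: "Ck_on 2 (\<lambda>y. f y $ i) S" for i
    using assms(1,2) by (rule Ck_on_nth)
  have d: "dx i (\<lambda>y. f y $ i) differentiable (at z)" for i
    using C[of i] by (intro Ck_on_differentiable[OF Ck_on_dx[OF \<open>open S\<close>, of 1] _ \<open>z \<in> S\<close>]) (simp_all add: numeral_2_eq_2)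
  have "divv (dt f) z = (\<Sum>i\<in>UNIV. dx i (dt (\<lambda>y. f y $ i)) z)"
    unfolding divv_def
    by (intro sum.cong refl dx_cong[OF assms(1,3)] dt_vec_nth Ck_on_differentiable[OF assms(2)]) simp_all
  also have "\<dots> = (\<Sum>i\<in>UNIV. frechet_derivative (dx i (\<lambda>y. f y $ i)) (at z) (0, 1))"
    by (intro sum.cong refl dt_dx_commute[OF assms(1) C assms(3)])
  also have "\<dots> = frechet_derivative (divv f) (at z) (0, 1)"
  proof -
    have "(divv f has_derivative (\<lambda>v. \<Sum>i\<in>UNIV. frechet_derivative (dx i (\<lambda>y. f y $ i)) (at z) v)) (at z)"
      unfolding divv_def[abs_def]
      by (intro has_derivative_sum) (use d in \<open>simp add: frechet_derivative_works\<close>)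
    from fun_cong[OF frechet_derivative_at[OF this], of "(0, 1)"] show ?thesis by simp
  qed
  finally show ?thesis .
qed

text \<open>Renaming the summation indices and exchanging the second derivatives reproduces the
  double sum with the transposed tensor, that is, with the opposite sign.\<close>

lemma divv_divt_antisymmetric:
  assumes "open S" "Ck_on 2 A S" "z \<in> S" and anti: "\<And>y i j. A y $ i $ j = - A y $ j $ i"
  shows "divv (divt A) z = 0"
proof -
  have C: "Ck_on 2 (\<lambda>y. A y $ i $ j) S" for i j
    using assms by (intro Ck_on_nth)
  have d: "dx i (\<lambda>y. A y $ i $ j) differentiable (at z)" for i j
    using C[of i j] by (intro Ck_on_differentiable[OF Ck_on_dx[OF \<open>open S\<close>, of 1] _ \<open>z \<in> S\<close>]) (simp_all add: numeral_2_eq_2)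
  have 1: "divv (divt A) z = (\<Sum>j\<in>UNIV. \<Sum>i\<in>UNIV. dx j (dx i (\<lambda>y. A y $ i $ j)) z)"
    unfolding divv_def divt_def by (simp add: dx_sum d)
  have 2: "(\<Sum>j\<in>UNIV. \<Sum>i\<in>UNIV. dx j (dx i (\<lambda>y. A y $ i $ j)) z)
      = (\<Sum>j\<in>UNIV. \<Sum>i\<in>UNIV. dx j (dx i (\<lambda>y. A y $ j $ i)) z)"
    by (subst sum.swap) (intro sum.cong refl dx_commute[OF \<open>open S\<close> C \<open>z \<in> S\<close>])
  have 3: "dx j (dx i (\<lambda>y. A y $ j $ i)) z = - dx j (dx i (\<lambda>y. A y $ i $ j)) z" for i j
  proof -
    have "dx i (\<lambda>y. A y $ j $ i) x = 0 - dx i (\<lambda>y. A y $ i $ j) x" if "x \<in> S" for x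
    proof -
      have "(\<lambda>y. A y $ i $ j) differentiable (at x)"
        using Ck_on_differentiable[OF C _ that] by simp
      then have "dx i (\<lambda>y. 0 - A y $ i $ j) x = dx i (\<lambda>y. 0) x - dx i (\<lambda>y. A y $ i $ j) x"
        by (intro dx_diff) simp_all
      then show ?thesis
        by (simp add: dx_const anti[of _ j i])
    qed
    then have "dx j (dx i (\<lambda>y. A y $ j $ i)) z = dx j (\<lambda>x. 0 - dx i (\<lambda>y. A y $ i $ j) x) z"
      by (rule dx_cong[OF \<open>open S\<close> \<open>z \<in> S\<close>])
    also have "\<dots> = - dx j (dx i (\<lambda>y. A y $ i $ j)) z"
      by (subst dx_diff) (simp_all add: d dx_const)
    finally show ?thesis .
  qed
  have "divv (divt A) z = (\<Sum>j\<in>UNIV. \<Sum>i\<in>UNIV. dx j (dx i (\<lambda>y. A y $ j $ i)) z)"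
    by (simp only: 1 2)
  also have "\<dots> = (\<Sum>j\<in>UNIV. \<Sum>i\<in>UNIV. - dx j (dx i (\<lambda>y. A y $ i $ j)) z)"
    by (intro sum.cong refl 3)
  also have "\<dots> = - divv (divt A) z"
    by (simp only: 1 sum_negf)
  finally show ?thesis by simp
qed

subsection \<open>Derivatives of the state functions\<close>

text \<open>The orders of smoothness are set by the Faraday flux: it contains first derivatives of
  u, B and the pressure through \<open>w_hat\<close> and \<open>\<beta>\<close>, and its double
  divergence needs class \<open>C\<^sup>2\<close>. Hence order 3 for the fields and
  \<open>p\<close>, and order 2 for \<open>F\<close>, \<open>\<tau>\<close> and the internal energy
  inside \<open>\<tau>\<close>. The remaining terms are differentiated once.\<close>

locale smooth_mgd = mgd p \<epsilon> \<mu> lam \<kappa> \<tau> F Q \<rho> u \<theta> B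
  for p \<epsilon> \<mu> lam \<kappa> :: "real \<Rightarrow> real \<Rightarrow> real"
    and \<tau> :: "real \<Rightarrow> real \<Rightarrow> real^'n \<Rightarrow> real^'n \<Rightarrow> real"
    and F :: "(real^'n) \<times> real \<Rightarrow> real^'n"
    and Q \<rho> :: "(real^'n) \<times> real \<Rightarrow> real"
    and u :: "(real^'n) \<times> real \<Rightarrow> real^'n"
    and \<theta> :: "(real^'n) \<times> real \<Rightarrow> real"
    and B :: "(real^'n) \<times> real \<Rightarrow> real^'n" +
  fixes G :: "((real^'n) \<times> real) set"
  assumes open_G: "open G"
    and p_smooth: "Ck_on 3 (\<lambda>(r, h). p r h) ({0<..} \<times> {0<..})"
    and \<epsilon>_smooth: "Ck_on 2 (\<lambda>(r, h). \<epsilon> r h) ({0<..} \<times> {0<..})"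
    and maxwell: "\<And>r h. 0 < r \<Longrightarrow> 0 < h \<Longrightarrow> p r h = h * D2 p r h + r\<^sup>2 * D1 \<epsilon> r h"
    and p_mono: "\<And>r h. 0 < r \<Longrightarrow> 0 < h \<Longrightarrow> 0 \<le> D1 p r h"
    and \<epsilon>_strict_mono: "\<And>r h. 0 < r \<Longrightarrow> 0 < h \<Longrightarrow> 0 < D2 \<epsilon> r h"
    and \<mu>_smooth: "Ck_on 1 (\<lambda>(r, h). \<mu> r h) ({0<..} \<times> {0<..})"
    and lam_smooth: "Ck_on 1 (\<lambda>(r, h). lam r h) ({0<..} \<times> {0<..})"
    and \<kappa>_smooth: "Ck_on 1 (\<lambda>(r, h). \<kappa> r h) ({0<..} \<times> {0<..})"
    and \<tau>_smooth: "Ck_on 2 (\<lambda>(r, e, v, b). \<tau> r e v b) {(r, \<epsilon> r h, v, b) | r h v b. 0 < r \<and> 0 < h}"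
    and \<tau>_pos: "\<And>r h v b. 0 < r \<Longrightarrow> 0 < h \<Longrightarrow> 0 < \<tau> r (\<epsilon> r h) v b"
    and F_smooth: "Ck_on 2 F G" and Q_smooth: "Ck_on 1 Q G"
    and fields_smooth: "Ck_on 3 \<rho> G" "Ck_on 3 u G" "Ck_on 3 \<theta> G" "Ck_on 3 B G"
    and fields_pos: "\<And>z. z \<in> G \<Longrightarrow> 0 < \<rho> z" "\<And>z. z \<in> G \<Longrightarrow> 0 < \<theta> z"
begin

section \<open>Regularity of the fields and of the auxiliary quantities\<close>

lemma Ck_fields: "k \<le> 3 \<Longrightarrow> Ck_on k \<rho> G" "k \<le> 3 \<Longrightarrow> Ck_on k u G"
  "k \<le> 3 \<Longrightarrow> Ck_on k \<theta> G" "k \<le> 3 \<Longrightarrow> Ck_on k B G"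
  using fields_smooth Ck_on_antimono by blast+

lemma Ck_data: "k \<le> 2 \<Longrightarrow> Ck_on k F G" "k \<le> 1 \<Longrightarrow> Ck_on k Q G"
  using F_smooth Q_smooth Ck_on_antimono by blast+

lemma \<rho>_neq_0: "z \<in> G \<Longrightarrow> \<rho> z \<noteq> 0"
  using fields_pos(1)[of z] by auto

lemma open_quadrant: "open ({0<..} \<times> {0<..} :: (real \<times> real) set)"
  by (intro open_Times open_greaterThan)

lemma fields_mem_quadrant: "z \<in> G \<Longrightarrow> (\<rho> z, \<theta> z) \<in> {0<..} \<times> {0<..}"
  by (simp add: fields_pos)

lemma Ck_state_function:
  fixes f :: "real \<Rightarrow> real \<Rightarrow> real"
  assumes "Ck_on k (\<lambda>(r, h). f r h) ({0<..} \<times> {0<..})" "k \<le> 3"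
  shows "Ck_on k (\<lambda>z. f (\<rho> z) (\<theta> z)) G"
  by (rule Ck_on_compose2[OF open_G assms(1) Ck_fields(1)[OF assms(2)] Ck_fields(3)[OF assms(2)]])
    (rule fields_mem_quadrant)

lemma Ck_prs: "k \<le> 3 \<Longrightarrow> Ck_on k prs G"
  unfolding prs_def[abs_def]
  by (rule Ck_on_antimono[OF Ck_state_function[OF p_smooth]]) simp_all

lemma Ck_eint: "k \<le> 2 \<Longrightarrow> Ck_on k eint G"
  unfolding eint_def[abs_def]
  by (rule Ck_on_antimono[OF Ck_state_function[OF \<epsilon>_smooth]]) simp_all

lemma Ck_coefficients: "k \<le> 1 \<Longrightarrow> Ck_on k (\<lambda>z. \<mu> (\<rho> z) (\<theta> z)) G" "k \<le> 1 \<Longrightarrow> Ck_on k (\<lambda>z. lam (\<rho> z) (\<theta> z)) G"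
  "k \<le> 1 \<Longrightarrow> Ck_on k kap G"
  unfolding kap_def[abs_def]
  by (rule Ck_on_antimono[OF Ck_state_function[OF \<mu>_smooth]] Ck_on_antimono[OF Ck_state_function[OF lam_smooth]]
      Ck_on_antimono[OF Ck_state_function[OF \<kappa>_smooth]]; simp)+

lemma Ck_state_partials: "k \<le> 1 \<Longrightarrow> Ck_on k (\<lambda>z. D1 p (\<rho> z) (\<theta> z)) G" "k \<le> 1 \<Longrightarrow> Ck_on k (\<lambda>z. D2 p (\<rho> z) (\<theta> z)) G"
  "k \<le> 1 \<Longrightarrow> Ck_on k (\<lambda>z. D2 \<epsilon> (\<rho> z) (\<theta> z)) G"
proof -
  have p: "Ck_on (Suc 1) (\<lambda>(r, h). p r h) ({0<..} \<times> {0<..})"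
    by (rule Ck_on_antimono[OF p_smooth]) simp
  have e: "Ck_on (Suc 1) (\<lambda>(r, h). \<epsilon> r h) ({0<..} \<times> {0<..})"
    by (rule Ck_on_antimono[OF \<epsilon>_smooth]) simp
  show "Ck_on k (\<lambda>z. D1 p (\<rho> z) (\<theta> z)) G" "Ck_on k (\<lambda>z. D2 p (\<rho> z) (\<theta> z)) G"
    "Ck_on k (\<lambda>z. D2 \<epsilon> (\<rho> z) (\<theta> z)) G" if "k \<le> 1"
    by (rule Ck_on_antimono[OF Ck_state_function[OF Ck_on_D1[OF open_quadrant p]]]
        Ck_on_antimono[OF Ck_state_function[OF Ck_on_D2[OF open_quadrant p]]]
        Ck_on_antimono[OF Ck_state_function[OF Ck_on_D2[OF open_quadrant e]]]; use that in simp)+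
qed

lemma Ck_tau: "k \<le> 2 \<Longrightarrow> Ck_on k tau G"
proof -
  have "Ck_on 2 (\<lambda>z. (\<lambda>(r, e, v, b). \<tau> r e v b) (\<rho> z, eint z, u z, B z)) G"
  proof (rule Ck_on_compose[OF open_G \<tau>_smooth])
    show "Ck_on 2 (\<lambda>z. (\<rho> z, eint z, u z, B z)) G"
      by (intro Ck_on_Pair open_G Ck_fields Ck_eint) simp_all
  qed (use fields_pos in \<open>auto simp: eint_def\<close>)
  then show "k \<le> 2 \<Longrightarrow> Ck_on k tau G"
    unfolding tau_def[abs_def] by (simp add: Ck_on_antimono)
qed

lemma tau_pos: "z \<in> G \<Longrightarrow> 0 < tau z"
  by (simp add: tau_def eint_def \<tau>_pos fields_pos)

lemmas Ck_intros = open_G Ck_on_const Ck_on_add Ck_on_diff Ck_on_minus Ck_on_scaleR Ck_on_mult Ck_on_inner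
  Ck_on_divide Ck_on_tensor Ck_on_matrix_vector_mult Ck_on_grad Ck_on_gradv Ck_on_divv Ck_on_divt Ck_on_convect
  Ck_fields Ck_data Ck_prs Ck_eint Ck_coefficients Ck_state_partials Ck_tau

lemma Ck_\<beta>: "k \<le> 2 \<Longrightarrow> Ck_on k \<beta> G"
  unfolding \<beta>_def[abs_def] by (intro Ck_intros) simp_all

lemma Ck_w: "k \<le> 2 \<Longrightarrow> Ck_on k w G"
  unfolding w_def[abs_def] power2_norm_eq_inner by (intro Ck_intros) (simp_all add: \<rho>_neq_0)

lemma Ck_w_hat: "k \<le> 2 \<Longrightarrow> Ck_on k w_hat G"
  unfolding w_hat_def[abs_def] power2_norm_eq_inner by (intro Ck_intros) (simp_all add: \<rho>_neq_0)

lemma Ck_Pi_NS: "k \<le> 1 \<Longrightarrow> Ck_on k Pi_NS G"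
proof -
  have "Ck_on k (\<lambda>z. transpose (gradv u z)) G" if "k \<le> 1" for k
    unfolding transpose_def
    by (intro Ck_on_vec open_G, simp only: vec_lambda_beta, intro Ck_on_nth Ck_on_gradv open_G Ck_fields)
      (use that in simp)
  then show "k \<le> 1 \<Longrightarrow> Ck_on k Pi_NS G"
    unfolding Pi_NS_def[abs_def] DD_def by (intro Ck_intros) simp_all
qed

lemma Ck_En: "k \<le> 2 \<Longrightarrow> Ck_on k En G"
  unfolding En_def[abs_def] power2_norm_eq_inner by (intro Ck_intros) simp_all

lemmas Ck_intros' = Ck_intros Ck_\<beta> Ck_w Ck_w_hat Ck_Pi_NS Ck_En

lemma differentiable_G: "Ck_on 1 f G \<Longrightarrow> z \<in> G \<Longrightarrow> f differentiable (at z)"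
  by (rule Ck_on_differentiable[OF _ zero_less_one])

lemma state_differentiable:
  "z \<in> G \<Longrightarrow> (\<lambda>(r, h). p r h) differentiable (at (\<rho> z, \<theta> z))"
  "z \<in> G \<Longrightarrow> (\<lambda>(r, h). \<epsilon> r h) differentiable (at (\<rho> z, \<theta> z))"
  using Ck_on_differentiable[OF p_smooth _ fields_mem_quadrant] Ck_on_differentiable[OF \<epsilon>_smooth _ fields_mem_quadrant]
  by simp_all

lemma U_simps [simp]: "fst (U z) = \<rho> z" "fst (snd (U z)) = u z" "fst (snd (snd (U z))) = \<theta> z"
  "snd (snd (snd (U z))) = B z" "energy (U z) = En z"
  by (simp_all add: U_def energy_def En_def eint_def)

section \<open>Chain rule for the functions of the state\<close>

lemma has_derivative_state_function:
  assumes "(\<lambda>(r, h). f r h) differentiable (at (\<rho> z, \<theta> z))"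
  shows "((\<lambda>s. f (fst s) (fst (snd (snd s)))) has_derivative
    (\<lambda>d. D1 f (\<rho> z) (\<theta> z) * fst d + D2 f (\<rho> z) (\<theta> z) * fst (snd (snd d)))) (at (U z))"
  using has_derivative_compose_partials[of f fst "U z" "\<lambda>s. fst (snd (snd s))" fst "\<lambda>s. fst (snd (snd s))"] assms
  by (simp add: U_def has_derivative_fst has_derivative_snd)

lemmas has_derivative_tensor = bounded_bilinear.FDERIV[OF bounded_bilinear_tensor]

lemma frechet_mass_density: "frechet_derivative mass_density (at (U z)) (r, v, h, b) = r"
proof -
  have eq: "mass_density = fst"
    by (auto simp: mass_density_def fun_eq_iff)
  have "(mass_density has_derivative fst) (at (U z))"
    unfolding eq by (simp add: has_derivative_fst)
  from frechet_derivative_at[OF this, symmetric] show ?thesis by simp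
qed

lemma frechet_magnetic_field: "frechet_derivative magnetic_field (at (U z)) (r, v, h, b) = b"
proof -
  have eq: "magnetic_field = (\<lambda>s. snd (snd (snd s)))"
    by (auto simp: magnetic_field_def fun_eq_iff)
  have "(magnetic_field has_derivative (\<lambda>d. snd (snd (snd d)))) (at (U z))"
    unfolding eq by (simp add: has_derivative_snd)
  from frechet_derivative_at[OF this, symmetric] show ?thesis by simp
qed

lemma frechet_momentum:
  "frechet_derivative momentum (at (U z)) (r, v, h, b) = \<rho> z *\<^sub>R v + r *\<^sub>R u z"
proof -
  have eq: "momentum = (\<lambda>s. fst s *\<^sub>R fst (snd s))"
    by (auto simp: momentum_def fun_eq_iff)
  have "(momentum has_derivative (\<lambda>d. \<rho> z *\<^sub>R fst (snd d) + fst d *\<^sub>R u z)) (at (U z))"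
    unfolding eq by (auto intro!: derivative_eq_intros)
  from frechet_derivative_at[OF this, symmetric] show ?thesis by simp
qed

lemma frechet_impulse_flux:
  "frechet_derivative impulse_flux (at (U z)) (r, v, h, b)
    = (\<rho> z *\<^sub>R v + r *\<^sub>R u z) \<otimes> u z + (\<rho> z *\<^sub>R u z) \<otimes> v - (b \<otimes> B z + B z \<otimes> b)"
proof -
  have eq: "impulse_flux = (\<lambda>s. (fst s *\<^sub>R fst (snd s)) \<otimes> fst (snd s) - snd (snd (snd s)) \<otimes> snd (snd (snd s)))"
    by (auto simp: impulse_flux_def fun_eq_iff)
  have "(impulse_flux has_derivative (\<lambda>d.
      ((\<rho> z *\<^sub>R u z) \<otimes> fst (snd d) + (\<rho> z *\<^sub>R fst (snd d) + fst d *\<^sub>R u z) \<otimes> u z)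
      - (B z \<otimes> snd (snd (snd d)) + snd (snd (snd d)) \<otimes> B z))) (at (U z))"
    unfolding eq by (auto intro!: derivative_eq_intros has_derivative_tensor)
  from frechet_derivative_at[OF this, symmetric] show ?thesis by simp
qed

lemma frechet_faraday_flux:
  "frechet_derivative faraday_flux (at (U z)) (r, v, h, b) = u z \<otimes> b + v \<otimes> B z - (B z \<otimes> v + b \<otimes> u z)"
proof -
  have eq: "faraday_flux = (\<lambda>s. fst (snd s) \<otimes> snd (snd (snd s)) - snd (snd (snd s)) \<otimes> fst (snd s))"
    by (auto simp: faraday_flux_def fun_eq_iff)
  have "(faraday_flux has_derivative (\<lambda>d. (u z \<otimes> snd (snd (snd d)) + fst (snd d) \<otimes> B z)
      - (B z \<otimes> fst (snd d) + snd (snd (snd d)) \<otimes> u z))) (at (U z))"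
    unfolding eq by (auto intro!: derivative_eq_intros has_derivative_tensor)
  from frechet_derivative_at[OF this, symmetric] show ?thesis by simp
qed

lemma frechet_total_pressure:
  assumes "z \<in> G"
  shows "frechet_derivative total_pressure (at (U z)) (r, v, h, b)
    = D1 p (\<rho> z) (\<theta> z) * r + D2 p (\<rho> z) (\<theta> z) * h + B z \<bullet> b"
proof -
  have eq: "total_pressure = (\<lambda>s. p (fst s) (fst (snd (snd s))) + 1/2 * (snd (snd (snd s)) \<bullet> snd (snd (snd s))))"
    by (auto simp: total_pressure_def fun_eq_iff power2_norm_eq_inner)
  have "(total_pressure has_derivative (\<lambda>d.
      (D1 p (\<rho> z) (\<theta> z) * fst d + D2 p (\<rho> z) (\<theta> z) * fst (snd (snd d))) + B z \<bullet> snd (snd (snd d)))) (at (U z))"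
    unfolding eq by (auto intro!: derivative_eq_intros has_derivative_state_function[OF state_differentiable(1)[OF assms]]
        simp: inner_commute)
  from frechet_derivative_at[OF this, symmetric] show ?thesis by simp
qed

lemma has_derivative_energy:
  assumes "z \<in> G"
  shows "(energy has_derivative (\<lambda>d. 1/2 * fst d * (u z \<bullet> u z) + \<rho> z * (u z \<bullet> fst (snd d)) + fst d * eint z
    + \<rho> z * (D1 \<epsilon> (\<rho> z) (\<theta> z) * fst d + D2 \<epsilon> (\<rho> z) (\<theta> z) * fst (snd (snd d))))) (at (U z))"
proof -
  have eq: "energy = (\<lambda>s. 1/2 * fst s * (fst (snd s) \<bullet> fst (snd s)) + fst s * \<epsilon> (fst s) (fst (snd (snd s))))"
    by (auto simp: energy_def fun_eq_iff power2_norm_eq_inner)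
  show ?thesis
    unfolding eq by (auto intro!: derivative_eq_intros has_derivative_state_function[OF state_differentiable(2)[OF assms]]
        simp: eint_def inner_commute algebra_simps)
qed

lemma frechet_total_energy:
  assumes "z \<in> G"
  shows "frechet_derivative total_energy (at (U z)) (r, v, h, b)
    = 1/2 * r * (u z \<bullet> u z) + \<rho> z * (u z \<bullet> v) + r * eint z
    + \<rho> z * (D1 \<epsilon> (\<rho> z) (\<theta> z) * r + D2 \<epsilon> (\<rho> z) (\<theta> z) * h) + B z \<bullet> b"
proof -
  have eq: "total_energy = (\<lambda>s. energy s + 1/2 * (snd (snd (snd s)) \<bullet> snd (snd (snd s))))"
    by (auto simp: total_energy_def fun_eq_iff power2_norm_eq_inner)
  have "(total_energy has_derivative (\<lambda>d. (1/2 * fst d * (u z \<bullet> u z) + \<rho> z * (u z \<bullet> fst (snd d)) + fst d * eint z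
    + \<rho> z * (D1 \<epsilon> (\<rho> z) (\<theta> z) * fst d + D2 \<epsilon> (\<rho> z) (\<theta> z) * fst (snd (snd d)))) + B z \<bullet> snd (snd (snd d)))) (at (U z))"
    unfolding eq by (auto intro!: derivative_eq_intros has_derivative_energy[OF assms] simp: inner_commute)
  from frechet_derivative_at[OF this, symmetric] show ?thesis by simp
qed

lemma frechet_energy_flux:
  assumes "z \<in> G"
  shows "frechet_derivative energy_flux (at (U z)) (r, v, h, b)
    = (En z + prs z + B z \<bullet> B z) *\<^sub>R v
      + (1/2 * r * (u z \<bullet> u z) + \<rho> z * (u z \<bullet> v) + r * eint z
         + \<rho> z * (D1 \<epsilon> (\<rho> z) (\<theta> z) * r + D2 \<epsilon> (\<rho> z) (\<theta> z) * h)
         + (D1 p (\<rho> z) (\<theta> z) * r + D2 p (\<rho> z) (\<theta> z) * h) + 2 * (B z \<bullet> b)) *\<^sub>R u z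
      - ((u z \<bullet> B z) *\<^sub>R b + (u z \<bullet> b + v \<bullet> B z) *\<^sub>R B z)"
proof -
  have eq: "energy_flux = (\<lambda>s. (energy s + p (fst s) (fst (snd (snd s))) + snd (snd (snd s)) \<bullet> snd (snd (snd s))) *\<^sub>R fst (snd s)
      - (fst (snd s) \<bullet> snd (snd (snd s))) *\<^sub>R snd (snd (snd s)))"
    by (auto simp: energy_flux_def fun_eq_iff power2_norm_eq_inner)
  have "(energy_flux has_derivative (\<lambda>d. (En z + prs z + B z \<bullet> B z) *\<^sub>R fst (snd d)
      + (1/2 * fst d * (u z \<bullet> u z) + \<rho> z * (u z \<bullet> fst (snd d)) + fst d * eint z
         + \<rho> z * (D1 \<epsilon> (\<rho> z) (\<theta> z) * fst d + D2 \<epsilon> (\<rho> z) (\<theta> z) * fst (snd (snd d)))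
         + (D1 p (\<rho> z) (\<theta> z) * fst d + D2 p (\<rho> z) (\<theta> z) * fst (snd (snd d))) + 2 * (B z \<bullet> snd (snd (snd d)))) *\<^sub>R u z
      - ((u z \<bullet> B z) *\<^sub>R snd (snd (snd d)) + (u z \<bullet> snd (snd (snd d)) + fst (snd d) \<bullet> B z) *\<^sub>R B z))) (at (U z))"
    unfolding eq by (auto intro!: derivative_eq_intros has_derivative_energy[OF assms]
        has_derivative_state_function[OF state_differentiable(1)[OF assms]]
        simp: inner_commute prs_def)
  from frechet_derivative_at[OF this, symmetric] show ?thesis by simp
qed

subsection \<open>Inviscid rates and regularized fluxes\<close>

lemma state_functions_U:
  "momentum (U y) = \<rho> y *\<^sub>R u y"
  "impulse_flux (U y) = (\<rho> y *\<^sub>R u y) \<otimes> u y - B y \<otimes> B y"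
  "total_pressure (U y) = prs y + 1/2 * (B y \<bullet> B y)"
  "energy_flux (U y) = (En y + prs y + B y \<bullet> B y) *\<^sub>R u y - (u y \<bullet> B y) *\<^sub>R B y"
  "faraday_flux (U y) = u y \<otimes> B y - B y \<otimes> u y"
  by (simp_all add: U_def momentum_def impulse_flux_def total_pressure_def energy_flux_def faraday_flux_def
      energy_def En_def prs_def eint_def power2_norm_eq_inner)

lemma differentiable_fields:
  assumes "z \<in> G"
  shows "\<rho> differentiable (at z)" "u differentiable (at z)" "\<theta> differentiable (at z)" "B differentiable (at z)"
    "prs differentiable (at z)" "eint differentiable (at z)"
  by (rule differentiable_G[OF _ assms]; intro Ck_intros; simp)+

text \<open>Expanding \<open>div (\<rho> u \<otimes> u)\<close> produces the convective term of
  \<open>w_hat\<close> and the extra term \<open>div (\<rho> u) u\<close>, which only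
  \<open>w\<close> contains.\<close>

lemma rho_w:
  assumes "z \<in> G"
  shows "\<rho> z *\<^sub>R w z = \<rho> z *\<^sub>R w_hat z + (tau z * divv (\<lambda>y. \<rho> y *\<^sub>R u y) z) *\<^sub>R u z"
proof -
  note d = differentiable_fields[OF assms]
  have "divt (\<lambda>y. (\<rho> y *\<^sub>R u y) \<otimes> u y - B y \<otimes> B y) z
      = divt (\<lambda>y. (\<rho> y *\<^sub>R u y) \<otimes> u y) z - divt (\<lambda>y. B y \<otimes> B y) z"
    by (intro divt_diff; rule differentiable_G[OF _ assms]; intro Ck_intros; simp)
  also have "divt (\<lambda>y. (\<rho> y *\<^sub>R u y) \<otimes> u y) z
      = divv (\<lambda>y. \<rho> y *\<^sub>R u y) z *\<^sub>R u z + convect (\<lambda>y. \<rho> y *\<^sub>R u y) u z"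
    by (intro divt_tensor; rule differentiable_G[OF _ assms]; intro Ck_intros; simp)
  also have "convect (\<lambda>y. \<rho> y *\<^sub>R u y) u z = \<rho> z *\<^sub>R convect u u z"
    by (simp add: convect_def vec_eq_iff sum_distrib_left mult.assoc)
  finally have A: "divt (\<lambda>y. (\<rho> y *\<^sub>R u y) \<otimes> u y - B y \<otimes> B y) z
      = divv (\<lambda>y. \<rho> y *\<^sub>R u y) z *\<^sub>R u z + \<rho> z *\<^sub>R convect u u z - divt (\<lambda>y. B y \<otimes> B y) z" .
  show ?thesis
    using \<rho>_neq_0[OF assms] unfolding w_def w_hat_def A by (simp add: vec_eq_iff algebra_simps)
qed

text \<open>The mass rate turns the impulse equation into an equation for \<open>v\<close> alone,
  where \<open>rho_w\<close> cancels the multiple of u. The rates themselves do not involve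
  \<open>\<tau>\<close>; the factor \<open>1 / tau z\<close> undoes the one built into
  \<open>w_hat\<close>.\<close>

lemma inviscid_rate_iff:
  assumes "z \<in> G"
  shows "inviscid_rate z (r, v, h, b) \<longleftrightarrow>
    r = - divv (\<lambda>y. \<rho> y *\<^sub>R u y) z \<and> v = - (1 / tau z) *\<^sub>R w_hat z \<and> b = - \<beta> z \<and>
    1/2 * r * (u z \<bullet> u z) + \<rho> z * (u z \<bullet> v) + r * eint z
    + \<rho> z * (D1 \<epsilon> (\<rho> z) (\<theta> z) * r + D2 \<epsilon> (\<rho> z) (\<theta> z) * h) + B z \<bullet> b
    = - divv (\<lambda>y. (En y + prs y + B y \<bullet> B y) *\<^sub>R u y - (u y \<bullet> B y) *\<^sub>R B y) z
      + \<rho> z * (u z \<bullet> F z) + Q z"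
proof -
  have pos: "\<rho> z \<noteq> 0" "tau z \<noteq> 0"
    using \<rho>_neq_0 tau_pos[OF assms] assms by auto
  let ?m = "divv (\<lambda>y. \<rho> y *\<^sub>R u y) z"
  have w: "- divt (\<lambda>y. (\<rho> y *\<^sub>R u y) \<otimes> u y - B y \<otimes> B y) z - grad (\<lambda>y. prs y + 1/2 * (B y \<bullet> B y)) z + \<rho> z *\<^sub>R F z
      = - (1 / tau z) *\<^sub>R (\<rho> z *\<^sub>R w z)"
    using pos unfolding w_def power2_norm_eq_inner by (simp add: algebra_simps)
  have "\<rho> z *\<^sub>R v + (- ?m) *\<^sub>R u z = - (1 / tau z) *\<^sub>R (\<rho> z *\<^sub>R w z) \<longleftrightarrow> v = - (1 / tau z) *\<^sub>R w_hat z"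
  proof -
    have "- (1 / tau z) *\<^sub>R (\<rho> z *\<^sub>R w z) = \<rho> z *\<^sub>R (- (1 / tau z) *\<^sub>R w_hat z) + (- ?m) *\<^sub>R u z"
      unfolding rho_w[OF assms] using pos by (simp add: algebra_simps)
    then show ?thesis
      using pos by (simp only: add_right_cancel scaleR_cancel_left) simp
  qed
  then show ?thesis
    unfolding inviscid_rate_def frechet_mass_density frechet_magnetic_field frechet_momentum
      frechet_total_energy[OF assms] state_functions_U w \<beta>_def by blast
qed

text \<open>With the other rates fixed, the energy equation is linear in the temperature rate with
  coefficient \<open>\<rho> \<epsilon>\<^sub>\<theta> > 0\<close>. This makes the definite
  description in \<open>hat_dt\<close> meaningful, for every B.\<close>

lemma the_inviscid_rate:
  assumes "z \<in> G"
  obtains h where "(THE V. inviscid_rate z V) = (- divv (\<lambda>y. \<rho> y *\<^sub>R u y) z, - (1 / tau z) *\<^sub>R w_hat z, h, - \<beta> z)"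
    and "inviscid_rate z (- divv (\<lambda>y. \<rho> y *\<^sub>R u y) z, - (1 / tau z) *\<^sub>R w_hat z, h, - \<beta> z)"
proof -
  have pos: "\<rho> z * D2 \<epsilon> (\<rho> z) (\<theta> z) \<noteq> 0"
    using \<rho>_neq_0[OF assms] \<epsilon>_strict_mono[of "\<rho> z" "\<theta> z"] fields_pos[OF assms] by simp
  let ?r = "- divv (\<lambda>y. \<rho> y *\<^sub>R u y) z" and ?v = "- (1 / tau z) *\<^sub>R w_hat z" and ?b = "- \<beta> z"
  \<comment> \<open>What the energy equation leaves for
    \<open>\<rho> \<epsilon>\<^sub>\<theta> h\<close> once all other rates are inserted.\<close>
  define e where "e = - divv (\<lambda>y. (En y + prs y + B y \<bullet> B y) *\<^sub>R u y - (u y \<bullet> B y) *\<^sub>R B y) z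
    + \<rho> z * (u z \<bullet> F z) + Q z - (1/2 * ?r * (u z \<bullet> u z) + \<rho> z * (u z \<bullet> ?v) + ?r * eint z
      + \<rho> z * D1 \<epsilon> (\<rho> z) (\<theta> z) * ?r + B z \<bullet> ?b)"
  define h where "h = e / (\<rho> z * D2 \<epsilon> (\<rho> z) (\<theta> z))"
  have iff: "inviscid_rate z (r, v, h', b) \<longleftrightarrow> r = ?r \<and> v = ?v \<and> b = ?b \<and> \<rho> z * D2 \<epsilon> (\<rho> z) (\<theta> z) * h' = e"
    for r v h' b
    unfolding inviscid_rate_iff[OF assms] e_def by (intro conj_cong refl) (simp add: algebra_simps; linarith)
  have "\<rho> z * D2 \<epsilon> (\<rho> z) (\<theta> z) * h' = e \<longleftrightarrow> h' = h" for h'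
    unfolding h_def using pos by (simp add: eq_divide_eq mult.commute)
  with iff have iff': "inviscid_rate z (r, v, h', b) \<longleftrightarrow> (r, v, h', b) = (?r, ?v, h, ?b)" for r v h' b
    by auto
  then have "inviscid_rate z V \<longleftrightarrow> V = (?r, ?v, h, ?b)" for V
    by (cases V) simp
  then show ?thesis
    by (intro that[of h]) simp_all
qed

text \<open>Here \<^term>\<open>divv B z = 0\<close> is indispensable: without it the right-hand side gains the term
  \<open>- (u \<bullet> B) div B\<close>.\<close>
lemma internal_energy_balance:
  assumes "z \<in> G" "divv B z = 0"
    and rate: "inviscid_rate z (r, v, h, b)"
  shows "\<rho> z * (D1 \<epsilon> (\<rho> z) (\<theta> z) * r + D2 \<epsilon> (\<rho> z) (\<theta> z) * h)
    = Q z - \<rho> z * (u z \<bullet> grad eint z) - prs z * divv u z"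
proof -
  note d = differentiable_fields[OF assms(1)]
  have pos: "\<rho> z \<noteq> 0" "tau z \<noteq> 0"
    using \<rho>_neq_0[OF assms(1)] tau_pos[OF assms(1)] by auto
  have du: "(\<lambda>y. u y \<bullet> u y) differentiable (at z)" and dB: "(\<lambda>y. B y \<bullet> B y) differentiable (at z)"
    and duB: "(\<lambda>y. u y \<bullet> B y) differentiable (at z)" and dE: "En differentiable (at z)"
    by (rule differentiable_G[OF _ assms(1)]; intro Ck_intros' ; simp)+
  have m: "divv (\<lambda>y. \<rho> y *\<^sub>R u y) z = \<rho> z * divv u z + u z \<bullet> grad \<rho> z"
    by (simp add: divv_scaleR d inner_commute)
  have BB: "divt (\<lambda>y. B y \<otimes> B y) z = convect B B z"
    by (simp add: divt_tensor d assms(2))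
  have gP: "grad (\<lambda>y. prs y + 1/2 * (B y \<bullet> B y)) z = grad prs z + (1/2) *\<^sub>R grad (\<lambda>y. B y \<bullet> B y) z"
    unfolding grad_cmult[OF dB, symmetric] by (rule grad_add) (use dB d in simp_all)
  have gBB: "u z \<bullet> grad (\<lambda>y. B y \<bullet> B y) z = 2 * (convect u B z \<bullet> B z)"
    by (simp add: inner_grad_inner d)
  have gE: "u z \<bullet> grad En z
      = \<rho> z * (convect u u z \<bullet> u z) + 1/2 * (u z \<bullet> u z) * (u z \<bullet> grad \<rho> z)
        + \<rho> z * (u z \<bullet> grad eint z) + eint z * (u z \<bullet> grad \<rho> z)"
  proof -
    have eq: "En = (\<lambda>y. \<rho> y * (1/2 * (u y \<bullet> u y)) + \<rho> y * eint y)"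
      by (simp add: fun_eq_iff En_def power2_norm_eq_inner)
    have "(\<lambda>y. \<rho> y * (1/2 * (u y \<bullet> u y))) differentiable (at z)" "(\<lambda>y. \<rho> y * eint y) differentiable (at z)"
      "(\<lambda>y. 1/2 * (u y \<bullet> u y)) differentiable (at z)"
      by (rule differentiable_G[OF _ assms(1)]; intro Ck_intros; simp)+
    then have "grad En z = \<rho> z *\<^sub>R ((1/2) *\<^sub>R grad (\<lambda>y. u y \<bullet> u y) z) + (1/2 * (u z \<bullet> u z)) *\<^sub>R grad \<rho> z
        + (\<rho> z *\<^sub>R grad eint z + eint z *\<^sub>R grad \<rho> z)"
      unfolding eq by (simp only: grad_add grad_mult grad_cmult du d)
    then show ?thesis
      using inner_grad_inner[OF d(2) d(2), of u] by (simp add: inner_add_right)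
  qed
  have D: "divv (\<lambda>y. (En y + prs y + B y \<bullet> B y) *\<^sub>R u y - (u y \<bullet> B y) *\<^sub>R B y) z
      = (En z + prs z + B z \<bullet> B z) * divv u z + (u z \<bullet> grad En z + u z \<bullet> grad prs z + 2 * (convect u B z \<bullet> B z))
        - (convect B u z \<bullet> B z + convect B B z \<bullet> u z)"
  proof -
    have "divv (\<lambda>y. (En y + prs y + B y \<bullet> B y) *\<^sub>R u y - (u y \<bullet> B y) *\<^sub>R B y) z
      = divv (\<lambda>y. (En y + prs y + B y \<bullet> B y) *\<^sub>R u y) z - divv (\<lambda>y. (u y \<bullet> B y) *\<^sub>R B y) z"
      by (rule divv_diff; rule differentiable_G[OF _ assms(1)]; intro Ck_intros'; simp)
    moreover have "divv (\<lambda>y. (u y \<bullet> B y) *\<^sub>R B y) z = convect B u z \<bullet> B z + convect B B z \<bullet> u z"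
      using inner_grad_inner[OF d(2) d(4), of B] by (simp add: divv_scaleR duB d assms(2) inner_commute)
    moreover have "divv (\<lambda>y. (En y + prs y + B y \<bullet> B y) *\<^sub>R u y) z
      = (En z + prs z + B z \<bullet> B z) * divv u z + u z \<bullet> grad (\<lambda>y. En y + prs y + B y \<bullet> B y) z"
      using dE dB d by (simp add: divv_scaleR inner_commute)
    moreover have "grad (\<lambda>y. En y + prs y + B y \<bullet> B y) z = grad En z + grad prs z + grad (\<lambda>y. B y \<bullet> B y) z"
      using dE dB d by (simp add: grad_add)
    ultimately show ?thesis
      by (simp add: inner_add_right gBB)
  qed
  have \<beta>: "\<beta> z = divv u z *\<^sub>R B z + convect u B z - convect B u z"
  proof -
    have "\<beta> z = divt (\<lambda>y. u y \<otimes> B y) z - divt (\<lambda>y. B y \<otimes> u y) z"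
      unfolding \<beta>_def by (rule divt_diff; rule differentiable_G[OF _ assms(1)]; intro Ck_intros'; simp)
    then show ?thesis
      by (simp add: divt_tensor d assms(2))
  qed
  from rate have r: "r = - (\<rho> z * divv u z + u z \<bullet> grad \<rho> z)" and v: "v = - (1 / tau z) *\<^sub>R w_hat z"
    and b: "b = - \<beta> z" and E: "1/2 * r * (u z \<bullet> u z) + \<rho> z * (u z \<bullet> v) + r * eint z
    + \<rho> z * (D1 \<epsilon> (\<rho> z) (\<theta> z) * r + D2 \<epsilon> (\<rho> z) (\<theta> z) * h) + B z \<bullet> b
    = - divv (\<lambda>y. (En y + prs y + B y \<bullet> B y) *\<^sub>R u y - (u y \<bullet> B y) *\<^sub>R B y) z
      + \<rho> z * (u z \<bullet> F z) + Q z"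
    unfolding inviscid_rate_iff[OF assms(1)] m by blast+
  \<comment> \<open>The impulse equation, to be tested with u: this gives the kinetic part of the
    energy balance.\<close>
  have "\<rho> z *\<^sub>R v = - (\<rho> z *\<^sub>R convect u u z - convect B B z
      + (grad prs z + (1/2) *\<^sub>R grad (\<lambda>y. B y \<bullet> B y) z) - \<rho> z *\<^sub>R F z)"
    unfolding v w_hat_def power2_norm_eq_inner gP BB using pos by simp
  then have "\<rho> z * (u z \<bullet> v) = u z \<bullet> (- (\<rho> z *\<^sub>R convect u u z - convect B B z
      + (grad prs z + (1/2) *\<^sub>R grad (\<lambda>y. B y \<bullet> B y) z) - \<rho> z *\<^sub>R F z))"
    by (metis inner_scaleR_right)
  then have uv: "\<rho> z * (u z \<bullet> v) = - (\<rho> z * (convect u u z \<bullet> u z) - convect B B z \<bullet> u z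
      + (u z \<bullet> grad prs z + convect u B z \<bullet> B z) - \<rho> z * (u z \<bullet> F z))"
    by (simp add: inner_diff_right inner_add_right gBB inner_commute)
  \<comment> \<open>The Faraday equation tested with B: the magnetic part of the energy
    balance.\<close>
  have Bb: "B z \<bullet> b = - (divv u z * (B z \<bullet> B z) + convect u B z \<bullet> B z - convect B u z \<bullet> B z)"
    by (simp add: b \<beta> inner_diff_right inner_add_right inner_commute)
  have En: "En z = 1/2 * \<rho> z * (u z \<bullet> u z) + \<rho> z * eint z"
    by (simp add: En_def power2_norm_eq_inner)
  \<comment> \<open>The magnetic convective terms, the work of the pressure gradient and that of the
    body force occur on both sides and cancel; the density rate removes the rest of the kinetic
    energy.\<close>
  show ?thesis
    using E unfolding uv Bb D gE En r by (simp add: algebra_simps)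
qed

text \<open>The conditions on the state functions make the radicand nonnegative, so the square root
  can be eliminated wherever the speed of sound occurs squared.\<close>

lemma C_s_squared:
  assumes "z \<in> G"
  shows "(C_s z)\<^sup>2 = D1 p (\<rho> z) (\<theta> z)
     + \<theta> z * (D2 p (\<rho> z) (\<theta> z))\<^sup>2 / ((\<rho> z)\<^sup>2 * D2 \<epsilon> (\<rho> z) (\<theta> z))"
  unfolding C_s_def using fields_pos[OF assms] p_mono \<epsilon>_strict_mono
  by (intro real_sqrt_pow2 add_nonneg_nonneg divide_nonneg_nonneg mult_nonneg_nonneg) (simp_all add: less_imp_le)

text \<open>The temperature rate contributes \<open>\<theta> p\<^sub>\<theta>\<^sup>2 / (\<rho>
  \<epsilon>\<^sub>\<theta>)\<close> and the density rate \<open>\<rho> p\<^sub>\<rho>\<close> to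
  the coefficient of \<open>- div u\<close>; their sum is \<open>\<rho> C_s\<^sup>2\<close>.\<close>

lemma pressure_rate:
  assumes "z \<in> G" "divv B z = 0" and rate: "inviscid_rate z (r, v, h, b)"
  shows "D1 p (\<rho> z) (\<theta> z) * r + D2 p (\<rho> z) (\<theta> z) * h
    = - (u z \<bullet> grad prs z + \<rho> z * (C_s z)\<^sup>2 * divv u z
        - D2 p (\<rho> z) (\<theta> z) / (\<rho> z * D2 \<epsilon> (\<rho> z) (\<theta> z)) * Q z)"
proof -
  note d = differentiable_fields[OF assms(1)]
  have r: "r = - (\<rho> z * divv u z + u z \<bullet> grad \<rho> z)"
    using rate d by (simp add: inviscid_rate_iff[OF assms(1)] divv_scaleR inner_commute)
  have gp: "u z \<bullet> grad prs z = D1 p (\<rho> z) (\<theta> z) * (u z \<bullet> grad \<rho> z) + D2 p (\<rho> z) (\<theta> z) * (u z \<bullet> grad \<theta> z)"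
    using grad_compose_partials[OF state_differentiable(1)[OF assms(1)] d(1,3)]
    by (simp add: prs_def[abs_def] inner_add_right)
  have ge: "u z \<bullet> grad eint z = D1 \<epsilon> (\<rho> z) (\<theta> z) * (u z \<bullet> grad \<rho> z) + D2 \<epsilon> (\<rho> z) (\<theta> z) * (u z \<bullet> grad \<theta> z)"
    using grad_compose_partials[OF state_differentiable(2)[OF assms(1)] d(1,3)]
    by (simp add: eint_def[abs_def] inner_add_right)
  have mx: "prs z = \<theta> z * D2 p (\<rho> z) (\<theta> z) + (\<rho> z)\<^sup>2 * D1 \<epsilon> (\<rho> z) (\<theta> z)"
    unfolding prs_def by (rule maxwell) (use fields_pos[OF assms(1)] in simp_all)
  have pos: "\<rho> z > 0" "D2 \<epsilon> (\<rho> z) (\<theta> z) > 0"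
    using fields_pos[OF assms(1)] \<epsilon>_strict_mono by simp_all
  \<comment> \<open>The Maxwell relation enters here: the coefficient
    \<open>p - \<rho>\<^sup>2 \<epsilon>\<^sub>\<rho>\<close> of \<open>div u\<close> is
    \<open>\<theta> p\<^sub>\<theta>\<close>.\<close>
  have "\<rho> z * D2 \<epsilon> (\<rho> z) (\<theta> z) * h
      = Q z - \<rho> z * D2 \<epsilon> (\<rho> z) (\<theta> z) * (u z \<bullet> grad \<theta> z) - \<theta> z * D2 p (\<rho> z) (\<theta> z) * divv u z"
    using internal_energy_balance[OF assms] unfolding r ge mx by (simp add: algebra_simps power2_eq_square)
  then have h: "h = (Q z - \<rho> z * D2 \<epsilon> (\<rho> z) (\<theta> z) * (u z \<bullet> grad \<theta> z) - \<theta> z * D2 p (\<rho> z) (\<theta> z) * divv u z)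
      / (\<rho> z * D2 \<epsilon> (\<rho> z) (\<theta> z))"
    using pos by (simp add: eq_divide_eq mult.commute)
  show ?thesis
    unfolding C_s_squared[OF assms(1)] gp r h using pos by (simp add: field_simps power2_eq_square)
qed

section \<open>Closed forms of the regularized fluxes\<close>

lemma reg_mass_density:
  assumes "z \<in> G"
  shows "reg mass_density z = \<rho> z - tau z * divv (\<lambda>y. \<rho> y *\<^sub>R u y) z"
  by (rule the_inviscid_rate[OF assms])
    (simp add: reg_def hat_dt_def frechet_mass_density, simp add: U_def mass_density_def)

lemma scaled_rates:
  assumes "z \<in> G"
  shows "tau z *\<^sub>R (- (1 / tau z) *\<^sub>R w_hat z) = - w_hat z"
    and "tau z *\<^sub>R (\<rho> z *\<^sub>R (- (1 / tau z) *\<^sub>R w_hat z) + (- divv (\<lambda>y. \<rho> y *\<^sub>R u y) z) *\<^sub>R u z) = - (\<rho> z *\<^sub>R w z)"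
  using tau_pos[OF assms] unfolding rho_w[OF assms] by (simp_all add: algebra_simps)

lemma reg_momentum:
  assumes "z \<in> G"
  shows "reg momentum z = \<rho> z *\<^sub>R (u z - w z)"
proof (rule the_inviscid_rate[OF assms])
  fix h assume h: "(THE V. inviscid_rate z V) = (- divv (\<lambda>y. \<rho> y *\<^sub>R u y) z, - (1 / tau z) *\<^sub>R w_hat z, h, - \<beta> z)"
  show ?thesis
    unfolding reg_def hat_dt_def h frechet_momentum scaled_rates(2)[OF assms] state_functions_U
    by (simp add: algebra_simps)
qed

text \<open>The part of the stress that the regularized impulse flux generates: its first term comes
  from the rate of the second factor in \<open>\<rho> u \<otimes> u\<close>, the others from the
  rate of \<open>B \<otimes> B\<close>.\<close>

definition impulse_correction :: "(real^'n) \<times> real \<Rightarrow> real^'n^'n" where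
  "impulse_correction z = (\<rho> z *\<^sub>R u z) \<otimes> w_hat z - tau z *\<^sub>R (\<beta> z \<otimes> B z + B z \<otimes> \<beta> z)"

text \<open>Under \<open>div B = 0\<close> this is \<open>- \<tau>\<close> times the inviscid rate
  of the total pressure.\<close>

definition pressure_correction :: "(real^'n) \<times> real \<Rightarrow> real" where
  "pressure_correction z = tau z * (u z \<bullet> grad prs z + \<rho> z * (C_s z)\<^sup>2 * divv u z + \<beta> z \<bullet> B z
     - D2 p (\<rho> z) (\<theta> z) / (\<rho> z * D2 \<epsilon> (\<rho> z) (\<theta> z)) * Q z)"

lemma Pi_reg_eq: "Pi_reg z = Pi_NS z + impulse_correction z + pressure_correction z *\<^sub>R mat 1"
  by (simp add: Pi_reg_def impulse_correction_def pressure_correction_def)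

lemma reg_impulse_flux:
  assumes "z \<in> G"
  shows "reg impulse_flux z = (\<rho> z *\<^sub>R (u z - w z)) \<otimes> u z - B z \<otimes> B z - impulse_correction z"
proof (rule the_inviscid_rate[OF assms])
  fix h assume h: "(THE V. inviscid_rate z V) = (- divv (\<lambda>y. \<rho> y *\<^sub>R u y) z, - (1 / tau z) *\<^sub>R w_hat z, h, - \<beta> z)"
  note s = scaled_rates[OF assms, unfolded vec_eq_iff, rule_format]
  \<comment> \<open>In each entry the momentum rate carries the first index and the velocity rate
    the second; given these two scaled rates the claim is a polynomial identity.\<close>
  have "reg impulse_flux z $ i $ j
      = ((\<rho> z *\<^sub>R (u z - w z)) \<otimes> u z - B z \<otimes> B z - impulse_correction z) $ i $ j" for i j
    unfolding reg_def hat_dt_def h frechet_impulse_flux state_functions_U impulse_correction_def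
    using s(1)[of j] s(2)[of i]
    by (simp only: tensor_nth vector_add_component vector_minus_component vector_scaleR_component
        vector_uminus_component real_scaleR_def) algebra
  then show ?thesis by (simp add: vec_eq_iff)
qed

lemma reg_faraday_flux:
  assumes "z \<in> G"
  shows "reg faraday_flux z = ((u z - w_hat z) \<otimes> B z - B z \<otimes> (u z - w_hat z))
    - tau z *\<^sub>R (u z \<otimes> \<beta> z - \<beta> z \<otimes> u z)"
proof (rule the_inviscid_rate[OF assms])
  fix h assume h: "(THE V. inviscid_rate z V) = (- divv (\<lambda>y. \<rho> y *\<^sub>R u y) z, - (1 / tau z) *\<^sub>R w_hat z, h, - \<beta> z)"
  note s = scaled_rates(1)[OF assms, unfolded vec_eq_iff, rule_format]
  have "reg faraday_flux z $ i $ j = (((u z - w_hat z) \<otimes> B z - B z \<otimes> (u z - w_hat z))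
    - tau z *\<^sub>R (u z \<otimes> \<beta> z - \<beta> z \<otimes> u z)) $ i $ j" for i j
    unfolding reg_def hat_dt_def h frechet_faraday_flux state_functions_U
    using s[of j] s[of i]
    by (simp only: tensor_nth vector_add_component vector_minus_component vector_scaleR_component
        vector_uminus_component real_scaleR_def) algebra
  then show ?thesis by (simp add: vec_eq_iff)
qed

lemma reg_total_pressure:
  assumes "z \<in> G" "divv B z = 0"
  shows "reg total_pressure z = prs z + 1/2 * (B z \<bullet> B z) - pressure_correction z"
proof (rule the_inviscid_rate[OF assms(1)])
  fix h assume h: "(THE V. inviscid_rate z V) = (- divv (\<lambda>y. \<rho> y *\<^sub>R u y) z, - (1 / tau z) *\<^sub>R w_hat z, h, - \<beta> z)"
    and rate: "inviscid_rate z (- divv (\<lambda>y. \<rho> y *\<^sub>R u y) z, - (1 / tau z) *\<^sub>R w_hat z, h, - \<beta> z)"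
  show ?thesis
    unfolding reg_def hat_dt_def h frechet_total_pressure[OF assms(1)] state_functions_U
      pressure_rate[OF assms rate] pressure_correction_def
    by (simp add: algebra_simps inner_commute)
qed

text \<open>Each correction has its own source. The kinetic rate
  \<open>\<rho> (u \<bullet> v)\<close> yields \<open>\<rho> u \<otimes> w_hat\<close> applied to u.
  The rate of \<open>(u \<bullet> B) B\<close> yields the \<beta>-terms of the stress. The rate of
  \<open>|B|\<^sup>2\<close> counts \<open>\<beta> \<bullet> B\<close> twice: once in the pressure
  correction, once as the separate term \<open>\<tau> (\<beta> \<bullet> B) u\<close>. The rest is
  balanced by the heat flux. Heat conduction and viscous work are added back because
  \<open>- q\<close> and \<open>Pi_reg\<close> contain them.\<close>

lemma reg_energy_flux:
  assumes "z \<in> G" "divv B z = 0"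
  shows "reg energy_flux z
    = ((En z + prs z) *\<^sub>R (u z - w z) + (B z \<bullet> B z) *\<^sub>R (u z - w_hat z) - ((u z - w_hat z) \<bullet> B z) *\<^sub>R B z)
      - (- q z + (tau z * (\<beta> z \<bullet> B z)) *\<^sub>R u z + Pi_reg z *v u z)
      + (kap z *\<^sub>R grad \<theta> z + Pi_NS z *v u z)"
proof (rule the_inviscid_rate[OF assms(1)])
  let ?m = "divv (\<lambda>y. \<rho> y *\<^sub>R u y) z"
  define v where "v = - (1 / tau z) *\<^sub>R w_hat z"
  fix h assume "(THE V. inviscid_rate z V) = (- ?m, - (1 / tau z) *\<^sub>R w_hat z, h, - \<beta> z)"
    and "inviscid_rate z (- ?m, - (1 / tau z) *\<^sub>R w_hat z, h, - \<beta> z)"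
  then have h: "(THE V. inviscid_rate z V) = (- ?m, v, h, - \<beta> z)" and rate: "inviscid_rate z (- ?m, v, h, - \<beta> z)"
    unfolding v_def by simp_all
  note d = differentiable_fields[OF assms(1)]
  have \<rho>: "\<rho> z \<noteq> 0" by (rule \<rho>_neq_0[OF assms(1)])
  have m: "?m = \<rho> z * divv u z + u z \<bullet> grad \<rho> z"
    by (simp add: divv_scaleR d inner_commute)
  have w: "w z = w_hat z + (tau z / \<rho> z * ?m) *\<^sub>R u z"
  proof -
    have "\<rho> z *\<^sub>R w z = \<rho> z *\<^sub>R (w_hat z + (tau z / \<rho> z * ?m) *\<^sub>R u z)"
      unfolding rho_w[OF assms(1)] using \<rho> by (simp add: algebra_simps)
    then show ?thesis using \<rho> by (simp only: scaleR_cancel_left) simp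
  qed
  have v: "tau z * (v $ i) = - (w_hat z $ i)" for i
    using tau_pos[OF assms(1)] by (simp add: v_def)
  have uv: "tau z * (u z \<bullet> v) = - (u z \<bullet> w_hat z)" and vB: "tau z * (v \<bullet> B z) = - (w_hat z \<bullet> B z)"
    using tau_pos[OF assms(1)] by (simp_all add: v_def)
  have En: "En z = 1/2 * \<rho> z * (u z \<bullet> u z) + \<rho> z * eint z"
    by (simp add: En_def power2_norm_eq_inner)
  have Pi: "(Pi_reg z *v u z) = Pi_NS z *v u z + (w_hat z \<bullet> u z) *\<^sub>R (\<rho> z *\<^sub>R u z)
      - tau z *\<^sub>R ((B z \<bullet> u z) *\<^sub>R \<beta> z + (\<beta> z \<bullet> u z) *\<^sub>R B z) + pressure_correction z *\<^sub>R u z"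
    by (simp add: Pi_reg_eq impulse_correction_def matrix_vector_mult_add_rdistrib
        matrix_vector_mult_diff_rdistrib scaleR_matrix_vector_assoc[symmetric] tensor_mult_vec)
  have pc: "pressure_correction z = - (tau z * (D1 p (\<rho> z) (\<theta> z) * (- ?m) + D2 p (\<rho> z) (\<theta> z) * h)) + tau z * (\<beta> z \<bullet> B z)"
    unfolding pressure_correction_def pressure_rate[OF assms rate] by (simp add: algebra_simps)
  \<comment> \<open>\<open>s1\<close> is the factor of u in \<open>w - w_hat\<close>, and
    \<open>s2\<close> is the factor of u that the regularization adds to \<open>- q\<close>.\<close>
  define s1 where "s1 = tau z / \<rho> z * ?m"
  define s2 where "s2 = tau z * (\<rho> z * (u z \<bullet> grad eint z - prs z / (\<rho> z)\<^sup>2 * (u z \<bullet> grad \<rho> z)) - Q z)"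
  \<comment> \<open>The origin of the regularized heat flux: \<open>s2\<close> is what remains of
    \<open>- \<tau>\<close> times the rate of \<open>E\<close> (without its part
    \<open>\<rho> (u \<bullet> v)\<close>) after removing the multiple of u created by using
    \<open>w\<close> in place of \<open>w_hat\<close>. The density gradient in \<open>q\<close> is
    the difference between \<open>p div (\<rho> u) / \<rho>\<close> and
    \<open>p div u\<close>.\<close>
  have K: "(En z + prs z) * s1 + s2 = tau z * (1/2 * ?m * (u z \<bullet> u z) + ?m * eint z
      - \<rho> z * (D1 \<epsilon> (\<rho> z) (\<theta> z) * (- ?m) + D2 \<epsilon> (\<rho> z) (\<theta> z) * h))"
    unfolding internal_energy_balance[OF assms rate] unfolding s1_def s2_def En m using \<rho>
    by (simp add: field_simps power2_eq_square)
  have "reg energy_flux z $ i = (((En z + prs z) *\<^sub>R (u z - w z) + (B z \<bullet> B z) *\<^sub>R (u z - w_hat z) - ((u z - w_hat z) \<bullet> B z) *\<^sub>R B z)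
      - (- q z + (tau z * (\<beta> z \<bullet> B z)) *\<^sub>R u z + Pi_reg z *v u z)
      + (kap z *\<^sub>R grad \<theta> z + Pi_NS z *v u z)) $ i" for i
    unfolding reg_def hat_dt_def h frechet_energy_flux[OF assms(1)] state_functions_U Pi q_def w pc
      s1_def[symmetric] s2_def[symmetric]
    using K v[of i] uv vB
    by (simp only: vector_add_component vector_minus_component vector_scaleR_component
        vector_uminus_component real_scaleR_def inner_diff_left inner_diff_right inner_minus_right inner_commute) algebra
  then show ?thesis by (simp add: vec_eq_iff)
qed

section \<open>From fluxes to equations\<close>

lemma Ck_corrections: "k \<le> 1 \<Longrightarrow> Ck_on k impulse_correction G" "k \<le> 1 \<Longrightarrow> Ck_on k pressure_correction G"
proof -
  show "Ck_on k impulse_correction G" if "k \<le> 1"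
    unfolding impulse_correction_def[abs_def] by (intro Ck_intros'; use that in simp)
  \<comment> \<open>Smoothness is shown with the radicand in place of the square, since the square
    root need not be differentiable where \<open>C_s\<close> vanishes.\<close>
  have "Ck_on k (\<lambda>z. tau z * (u z \<bullet> grad prs z + \<rho> z * (D1 p (\<rho> z) (\<theta> z)
     + \<theta> z * (D2 p (\<rho> z) (\<theta> z) * D2 p (\<rho> z) (\<theta> z)) / (\<rho> z * \<rho> z * D2 \<epsilon> (\<rho> z) (\<theta> z))) * divv u z + \<beta> z \<bullet> B z
     - D2 p (\<rho> z) (\<theta> z) / (\<rho> z * D2 \<epsilon> (\<rho> z) (\<theta> z)) * Q z)) G" if "k \<le> 1"
    using \<epsilon>_strict_mono fields_pos by (intro Ck_intros'; use that in \<open>force simp: less_imp_neq[symmetric]\<close>)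
  then show "Ck_on k pressure_correction G" if "k \<le> 1"
    using that by (subst Ck_on_cong[OF open_G]) (simp_all add: pressure_correction_def C_s_squared[unfolded power2_eq_square] power2_eq_square)
qed

lemmas Ck_intros'' = Ck_intros' Ck_corrections

text \<open>The constraint is assumed on all of \<open>G\<close>, not just at \<open>z\<close>: the
  flux identities get differentiated and must hold in a neighbourhood.\<close>

lemma divergence_identities:
  assumes "z \<in> G" "\<forall>y\<in>G. divv B y = 0"
  shows "divv (reg momentum) z = divv (\<lambda>y. \<rho> y *\<^sub>R (u y - w y)) z"
    and "divt (reg impulse_flux) z + grad (reg total_pressure) z
      = divt (\<lambda>y. (\<rho> y *\<^sub>R (u y - w y)) \<otimes> u y - B y \<otimes> B y) z
        + grad (\<lambda>y. prs y + 1/2 * (norm (B y))\<^sup>2) z + divt Pi_NS z - divt Pi_reg z"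
    and "divv (reg energy_flux) z
      = divv (\<lambda>y. (En y + prs y) *\<^sub>R (u y - w y) + (norm (B y))\<^sup>2 *\<^sub>R (u y - w_hat y)
                  - ((u y - w_hat y) \<bullet> B y) *\<^sub>R B y) z
        - divv (\<lambda>y. - q y + (tau y * (\<beta> y \<bullet> B y)) *\<^sub>R u y + Pi_reg y *v u y) z
        + divv (\<lambda>y. kap y *\<^sub>R grad \<theta> y + Pi_NS y *v u y) z"
    and "divt (reg faraday_flux) z = divt (\<lambda>y. (u y - w_hat y) \<otimes> B y - B y \<otimes> (u y - w_hat y)) z
        - divt (\<lambda>y. tau y *\<^sub>R (u y \<otimes> \<beta> y - \<beta> y \<otimes> u y)) z"
proof -
  note cong = open_G assms(1) and div_B = bspec[OF assms(2)]
  have diff: "f differentiable (at z)" if "Ck_on 1 f G" for f :: "(real^'n) \<times> real \<Rightarrow> 'b::real_normed_vector"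
    using that assms(1) by (rule differentiable_G)
  have Ck_Pi_reg: "Ck_on k Pi_reg G" if "k \<le> 1" for k
    unfolding Pi_reg_eq[abs_def] by (intro Ck_intros''; use that in simp)
  have Ck_q: "Ck_on k q G" if "k \<le> 1" for k
    unfolding q_def[abs_def] power2_eq_square
    by (intro Ck_intros''; use that \<rho>_neq_0 in simp)
  show "divv (reg momentum) z = divv (\<lambda>y. \<rho> y *\<^sub>R (u y - w y)) z"
    by (rule divv_cong[OF cong]) (rule reg_momentum)
  show "divt (reg faraday_flux) z = divt (\<lambda>y. (u y - w_hat y) \<otimes> B y - B y \<otimes> (u y - w_hat y)) z
        - divt (\<lambda>y. tau y *\<^sub>R (u y \<otimes> \<beta> y - \<beta> y \<otimes> u y)) z"
    by (subst divt_cong[OF cong reg_faraday_flux], assumption)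
      (intro divt_diff; rule diff; intro Ck_intros''; simp)
  show "divt (reg impulse_flux) z + grad (reg total_pressure) z
      = divt (\<lambda>y. (\<rho> y *\<^sub>R (u y - w y)) \<otimes> u y - B y \<otimes> B y) z
        + grad (\<lambda>y. prs y + 1/2 * (norm (B y))\<^sup>2) z + divt Pi_NS z - divt Pi_reg z"
  proof -
    have "divt (reg impulse_flux) z = divt (\<lambda>y. (\<rho> y *\<^sub>R (u y - w y)) \<otimes> u y - B y \<otimes> B y) z - divt impulse_correction z"
      by (subst divt_cong[OF cong reg_impulse_flux], assumption)
        (intro divt_diff; rule diff; intro Ck_intros''; simp)
    moreover have "grad (reg total_pressure) z = grad (\<lambda>y. prs y + 1/2 * (B y \<bullet> B y)) z - grad pressure_correction z"
      by (subst grad_cong[OF cong reg_total_pressure], assumption, rule div_B, assumption)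
        (intro grad_diff; rule diff; intro Ck_intros''; simp)
    moreover have "divt Pi_reg z = divt (\<lambda>y. Pi_NS y + impulse_correction y) z + divt (\<lambda>y. pressure_correction y *\<^sub>R mat 1) z"
      unfolding Pi_reg_eq[abs_def] by (intro divt_add; rule diff; intro Ck_intros''; simp)
    moreover have "divt (\<lambda>y. Pi_NS y + impulse_correction y) z = divt Pi_NS z + divt impulse_correction z"
      by (intro divt_add; rule diff; intro Ck_intros''; simp)
    ultimately show ?thesis
      by (simp add: power2_norm_eq_inner divt_scaleR_mat_1)
  qed
  show "divv (reg energy_flux) z
      = divv (\<lambda>y. (En y + prs y) *\<^sub>R (u y - w y) + (norm (B y))\<^sup>2 *\<^sub>R (u y - w_hat y)
                  - ((u y - w_hat y) \<bullet> B y) *\<^sub>R B y) z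
        - divv (\<lambda>y. - q y + (tau y * (\<beta> y \<bullet> B y)) *\<^sub>R u y + Pi_reg y *v u y) z
        + divv (\<lambda>y. kap y *\<^sub>R grad \<theta> y + Pi_NS y *v u y) z"
    unfolding power2_norm_eq_inner
    by (subst divv_cong[OF cong reg_energy_flux], assumption, rule div_B, assumption,
        subst divv_add, (rule diff, intro Ck_intros'' Ck_Pi_reg Ck_q; simp)+,
        subst divv_diff, (rule diff, intro Ck_intros'' Ck_Pi_reg Ck_q; simp)+, rule refl)
qed

lemma systems_equivalent:
  assumes "z \<in> G" "\<forall>y\<in>G. divv B y = 0"
  shows "regularized_system z \<longleftrightarrow> transformed_system z"
proof -
  note I = divergence_identities[OF assms]
  let ?L = "dt (\<lambda>y. \<rho> y *\<^sub>R u y) z" and ?R = "(\<rho> z - tau z * divv (\<lambda>y. \<rho> y *\<^sub>R u y) z) *\<^sub>R F z"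
  let ?A = "divt (\<lambda>y. (\<rho> y *\<^sub>R (u y - w y)) \<otimes> u y - B y \<otimes> B y) z"
  let ?P = "grad (\<lambda>y. prs y + 1/2 * (norm (B y))\<^sup>2) z"
  \<comment> \<open>Subtracting the right-hand side lets \<open>div Pi_NS\<close> cancel, so that
    only the divergence of the full regularized stress remains.\<close>
  have "?L + divt (reg impulse_flux) z + grad (reg total_pressure) z - (divt Pi_NS z + ?R)
      = ?L + (?A + ?P + divt Pi_NS z - divt Pi_reg z) - (divt Pi_NS z + ?R)"
    by (simp only: add.assoc[of ?L "divt (reg impulse_flux) z"] I(2))
  also have "\<dots> = ?L + ?A + ?P - (divt Pi_reg z + ?R)"
    by (simp only: algebra_simps)
  finally have "?L + divt (reg impulse_flux) z + grad (reg total_pressure) z - (divt Pi_NS z + ?R) = 0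
      \<longleftrightarrow> ?L + ?A + ?P - (divt Pi_reg z + ?R) = 0"
    by (rule arg_cong)
  then have "?L + divt (reg impulse_flux) z + grad (reg total_pressure) z = divt Pi_NS z + reg mass_density z *\<^sub>R F z
      \<longleftrightarrow> ?L + ?A + ?P = divt Pi_reg z + ?R"
    unfolding reg_mass_density[OF assms(1)] by (simp only: right_minus_eq)
  moreover have "reg momentum z \<bullet> F z = \<rho> z * ((u z - w z) \<bullet> F z)"
    by (simp add: reg_momentum[OF assms(1)])
  ultimately show ?thesis
    unfolding regularized_system_def transformed_system_def I(1,3,4) using assms by (auto simp: add_diff_eq)
qed

text \<open>The regularized magnetic flux is antisymmetric, so its double divergence vanishes.\<close>
lemma div_B_stationary:
  assumes "z \<in> G" and faraday: "\<And>y. y \<in> G \<Longrightarrow> dt B y + divt (reg faraday_flux) y = 0"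
  shows "frechet_derivative (divv B) (at z) (0, 1) = 0"
proof -
  \<comment> \<open>The closed form makes smoothness and antisymmetry visible, also outside
    \<open>G\<close>, where \<open>reg faraday_flux\<close> is not identified. It is available
    before anything is known about \<open>div B\<close>.\<close>
  let ?A = "\<lambda>y. ((u y - w_hat y) \<otimes> B y - B y \<otimes> (u y - w_hat y)) - tau y *\<^sub>R (u y \<otimes> \<beta> y - \<beta> y \<otimes> u y)"
  have A: "Ck_on 2 ?A G"
    by (intro Ck_intros'; simp)
  have B: "dt B y = 0 - divt ?A y" if "y \<in> G" for y
    using faraday[OF that] divt_cong[OF open_G that reg_faraday_flux] by (simp add: eq_neg_iff_add_eq_0)
  have "frechet_derivative (divv B) (at z) (0, 1) = divv (dt B) z"
    by (rule divv_dt_commute[OF open_G _ assms(1), symmetric]) (intro Ck_intros; simp)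
  also have "\<dots> = divv (\<lambda>y. 0 - divt ?A y) z"
    by (rule divv_cong[OF open_G assms(1)]) (rule B)
  also have "\<dots> = divv (\<lambda>y. 0) z - divv (divt ?A) z"
    by (rule divv_diff; rule differentiable_G[OF _ assms(1)]; intro Ck_intros'; simp)
  also have "\<dots> = 0"
    using divv_divt_antisymmetric[OF open_G A assms(1)]
    by (simp add: divv_def[of "\<lambda>y. 0"] dx_const tensor_nth algebra_simps)
  finally show ?thesis .
qed

end

text \<open>The fields are prescribed for positive times only, so the initial constraint is a limit
  as time tends to 0, taken at each fixed point of \<Omega>. That is enough, because
  \<open>div B\<close> is propagated along each vertical line separately.\<close>

theorem proposition1:
  fixes \<Omega> :: "(real^'n) set" and T :: real
    and p \<epsilon> \<mu> lam \<kappa> :: "real \<Rightarrow> real \<Rightarrow> real"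
    and \<tau> :: "real \<Rightarrow> real \<Rightarrow> real^'n \<Rightarrow> real^'n \<Rightarrow> real"
    and F u B :: "(real^'n) \<times> real \<Rightarrow> real^'n"
    and Q \<rho> \<theta> :: "(real^'n) \<times> real \<Rightarrow> real"
  assumes domain: "open \<Omega>" "connected \<Omega>" "\<Omega> \<noteq> {}" "0 < T"
    and state_smooth: "Ck_on 3 (\<lambda>(r, h). p r h) ({0<..} \<times> {0<..})"
      "Ck_on 2 (\<lambda>(r, h). \<epsilon> r h) ({0<..} \<times> {0<..})"
    and maxwell: "\<And>r h. 0 < r \<Longrightarrow> 0 < h \<Longrightarrow> p r h = h * D2 p r h + r\<^sup>2 * D1 \<epsilon> r h"
    and state_conditions: "\<And>r h. 0 < r \<Longrightarrow> 0 < h \<Longrightarrow> 0 \<le> D1 p r h"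
      "\<And>r h. 0 < r \<Longrightarrow> 0 < h \<Longrightarrow> 0 < D2 \<epsilon> r h"
    and coefficients_smooth: "Ck_on 1 (\<lambda>(r, h). \<mu> r h) ({0<..} \<times> {0<..})"
      "Ck_on 1 (\<lambda>(r, h). lam r h) ({0<..} \<times> {0<..})"
      "Ck_on 1 (\<lambda>(r, h). \<kappa> r h) ({0<..} \<times> {0<..})"
    and coefficients_nonneg: "\<And>r h. 0 < r \<Longrightarrow> 0 < h \<Longrightarrow> 0 \<le> \<mu> r h \<and> 0 \<le> lam r h \<and> 0 \<le> \<kappa> r h"
    and tau_smooth: "Ck_on 2 (\<lambda>(r, e, v, b). \<tau> r e v b)
      {(r, \<epsilon> r h, v, b) | r h v b. 0 < r \<and> 0 < h}"
    and tau_pos: "\<And>r h v b. 0 < r \<Longrightarrow> 0 < h \<Longrightarrow> 0 < \<tau> r (\<epsilon> r h) v b"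
    and data_smooth: "Ck_on 2 F (\<Omega> \<times> {0<..<T})" "Ck_on 1 Q (\<Omega> \<times> {0<..<T})"
    and heat_source_nonneg: "\<And>z. z \<in> \<Omega> \<times> {0<..<T} \<Longrightarrow> 0 \<le> Q z"
    and fields_smooth: "Ck_on 3 \<rho> (\<Omega> \<times> {0<..<T})" "Ck_on 3 u (\<Omega> \<times> {0<..<T})"
      "Ck_on 3 \<theta> (\<Omega> \<times> {0<..<T})" "Ck_on 3 B (\<Omega> \<times> {0<..<T})"
    and positive: "\<And>z. z \<in> \<Omega> \<times> {0<..<T} \<Longrightarrow> 0 < \<rho> z \<and> 0 < \<theta> z"
    and initial_div_B: "\<And>x. x \<in> \<Omega> \<Longrightarrow> ((\<lambda>t. divv B (x, t)) \<longlongrightarrow> 0) (at_right 0)"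
  shows "(\<forall>z \<in> \<Omega> \<times> {0<..<T}. mgd.regularized_system p \<epsilon> \<mu> lam \<kappa> \<tau> F Q \<rho> u \<theta> B z) \<longleftrightarrow>
         (\<forall>z \<in> \<Omega> \<times> {0<..<T}. mgd.transformed_system p \<epsilon> \<mu> lam \<kappa> \<tau> F Q \<rho> u \<theta> B z)"
proof -
  let ?G = "\<Omega> \<times> {0<..<T}"
  interpret smooth_mgd p \<epsilon> \<mu> lam \<kappa> \<tau> F Q \<rho> u \<theta> B ?G
  proof
    show "open ?G" by (rule open_Times[OF domain(1) open_greaterThanLessThan])
  qed (fact assms | use positive in blast)+
  have div_B: "divv B z = 0"
    if "z \<in> ?G" and reg: "\<forall>z\<in>?G. mgd.regularized_system p \<epsilon> \<mu> lam \<kappa> \<tau> F Q \<rho> u \<theta> B z" for z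
  proof -
    obtain x t where z: "z = (x, t)" and x: "x \<in> \<Omega>" and t: "t \<in> {0<..<T}"
      using \<open>z \<in> ?G\<close> by blast
    have "((\<lambda>s. divv B (x, s)) has_vector_derivative 0) (at s within {0<..<T})" if s: "s \<in> {0<..<T}" for s
    proof -
      have mem: "(x, s) \<in> ?G"
        using x s by simp
      have "Ck_on 1 (divv B) ?G"
        by (intro Ck_intros; simp)
      then have "divv B differentiable (at (x, s))"
        using mem by (rule differentiable_G)
      then have "((\<lambda>s. divv B (x, s)) has_vector_derivative frechet_derivative (divv B) (at (x, s)) (0, 1)) (at s)"
        unfolding frechet_derivative_works by (rule dt_has_vector_derivative)
      also have "frechet_derivative (divv B) (at (x, s)) (0, 1) = 0"
        by (rule div_B_stationary[OF mem]) (use reg[unfolded regularized_system_def] in blast)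
      finally show ?thesis
        by (rule has_vector_derivative_at_within)
    qed
    then obtain c where c: "\<And>s. s \<in> {0<..<T} \<Longrightarrow> divv B (x, s) = c"
      using has_vector_derivative_zero_constant[of "{0<..<T}" "\<lambda>s. divv B (x, s)"] by auto
    \<comment> \<open>The constant value near time 0 is its own limit, and uniqueness of limits
      identifies it with the initial value 0.\<close>
    have "eventually (\<lambda>s. divv B (x, s) = c) (at_right 0)"
      using \<open>0 < T\<close> by (rule eventually_at_rightI[rotated]) (rule c)
    then have "((\<lambda>s. divv B (x, s)) \<longlongrightarrow> c) (at_right 0)"
      by (rule tendsto_eventually)
    from tendsto_unique[OF trivial_limit_at_right_real this initial_div_B[OF x]] show ?thesis
      using c t z by simp
  qed
  show ?thesis
  proof
    assume "\<forall>z\<in>?G. mgd.regularized_system p \<epsilon> \<mu> lam \<kappa> \<tau> F Q \<rho> u \<theta> B z"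
    then show "\<forall>z\<in>?G. mgd.transformed_system p \<epsilon> \<mu> lam \<kappa> \<tau> F Q \<rho> u \<theta> B z"
      using systems_equivalent div_B by blast
  next
    \<comment> \<open>In this direction the constraint is itself one of the equations.\<close>
    assume "\<forall>z\<in>?G. mgd.transformed_system p \<epsilon> \<mu> lam \<kappa> \<tau> F Q \<rho> u \<theta> B z"
    then show "\<forall>z\<in>?G. mgd.regularized_system p \<epsilon> \<mu> lam \<kappa> \<tau> F Q \<rho> u \<theta> B z"
      using systems_equivalent unfolding transformed_system_def by blast
  qed
qed

end
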